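(* Let $((X^n(t))_{t\in[0,T]})_{n\in\mathbb{N}}$ be a family of $p$-dimensional, continuous, centered Gaussian processes, starting from zero, with independent components, which satisfies an LDP on $C([0,T],\mathbb{R}^p)$ with speed $\gamma_n$ and good rate function $$I(h)=\sum_{i=1}^p I_i(h_i),\qquad I_i(h_i)=\begin{cases}\frac12\|h_i\|^2_{\mathscr{H}_i} & h_i\in\mathscr{H}_i\\ +\infty & h_i\notin\mathscr{H}_i,\end{cases}$$ where $\mathscr{H}_i\subset C([0,T],\mathbb{R})$ is the reproducing kernel Hilbert space associated to some covariance function $k_{ii}$. Let $A^n=(\widetilde A^n_1,\ldots,\widetilde A^n_p)$, $n\in\mathbb{N}$, be independent of $(X^n)_{n\in\mathbb{N}}$, where, for each $i=1,\ldots,p$, $(\widetilde A^n_i)_{n\in\mathbb{N}}$ is a family of positive random variables satisfying the LDP on $[0,+\infty)$ with speed $\gamma_n$ and good rate function $x\mapsto d_ix^{\theta_i}$ ($x\ge0$), for some $d_1,\ldots,d_p>0$ and $\theta_1,\ldots,\theta_p>2$. Let $\hat b=(\hat b_1,\ldots,\hat b_p)\in C([0,T],\mathbb{R}^p)$ and $$Z^n(t)=A^n\circ X^n(t)+\hat b(t)\quad(t\in[0,T]),$$ where $u\circ v=(u_1v_1,\ldots,u_pv_p)$. Let $x_1,\ldots,x_p>0$ be such that $x_i-\hat b_i(t)>0$ for every $t\in[0,T]$ and $i=1,\ldots,p$. Set $$p_n:=\mathbb{P}\Big(\bigcap_{i=1}^p\Big\{\sup_{t\in[0,T]}Z^n_i(t)\ge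 x_i\Big\}\Big).$$ Then $$\lim_{n\to+\infty}\frac1{\gamma_n}\log(p_n)=-w_Q^{(\bot)},\qquad w_Q^{(\bot)}:=\inf_{t_1,\ldots,t_p\in[0,T]}\sum_{i=1}^p\psi(d_i,\theta_i)\left[\frac12\,\frac{(-\hat b_i(t_i)+x_i)^2}{k_{ii}(t_i,t_i)}\right]^{\theta_i/(\theta_i+2)}.$$
   Context: $T>0$ and $p\ge1$ are fixed; $C([0,T],\mathbb{R}^p)$ carries the sup-norm. For $d,\theta>0$, $$\psi(d,\theta):=2^{\theta/(\theta+2)}\Big(d(d\theta)^{-\theta/(\theta+2)}+\frac12(d\theta)^{2/(\theta+2)}\Big).$$ Quotients with positive numerator and zero denominator (e.g. at $t_i=0$, where $k_{ii}(0,0)=0$) are read as $+\infty$; a positive power of $+\infty$ is $+\infty$; $\log 0=-\infty$. Large deviation principle (LDP): let $E$ be a topological space with Borel $\sigma$-algebra and $\gamma_n>0$ with $\gamma_n\to+\infty$ (the speed). A rate function is a lower semicontinuous $I:E\to[0,+\infty]$; it is good if $\{I\le a\}$ is compact for all $a\ge0$. Probability measures $(\mu_n)$ satisfy the LDP on $E$ with rate function $I$ and speed $\gamma_n$ if $\liminf_n\frac1{\gamma_n}\log\mu_n(\Theta)\ge-\inf_{x\in\Theta}I(x)$ for every open $\Theta$ and $\limsup_n\frac1{\gamma_n}\log\mu_n(\Gamma)\le-\inf_{x\in\Gamma}I(x)$ for every closed $\Gamma$. Random elements satisfy an LDP if their laws do. Reproducing kernel Hilbert space (RKHS): let $U=(U(t))_{t\in[0,T]}$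 be a real continuous centered Gaussian process with covariance function $k$. Let $H$ be the $L^2$-closure of $\{\int_0^TU(t)\,d\lambda(t):\lambda\text{ a signed measure on }[0,T]\}$. The RKHS of $k$ is $\mathscr{H}=\{h: h(t)=\mathbb{E}[U(t)Y],\ Y\in H\}\subset C([0,T],\mathbb{R})$, with inner product transported from $L^2$ by the bijection $Y\mapsto\mathbb{E}[U(\cdot)Y]$. Equivalently it is the completion of the functions $x(t)=\int_0^Tk(t,s)\,d\lambda(s)$ under $\|x\|^2=\int_0^T\int_0^Tk(t,s)\,d\lambda(t)\,d\lambda(s)$.
   Formalization: The components of A^n are additionally assumed independent for each n; without this the claim fails, e.g. p=2 with both components of A^n equal, where the decay rate is strictly smaller than w_Q. *)

theory Defs
  imports "HOL-Probability.Probability"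
begin

section \<open>The space of continuous paths\<close>

text \<open>
  \<open>cfunspace\<close> carries the supremum metric; its points are extensional, i.e. they take
  the value \<^term>\<open>undefined\<close> outside \<open>[0,T]\<close>. Functions on the real line are therefore
  restricted to \<open>[0,T]\<close> before they are regarded as points of this space.
\<close>

definition path_space :: "real \<Rightarrow> (real \<Rightarrow> 'a::euclidean_space) topology" where
  "path_space T = mtopology_of (cfunspace (top_of_set {0..T}) euclidean_metric)"

definition sample_path :: "real \<Rightarrow> (real \<Rightarrow> 'w \<Rightarrow> 'a) \<Rightarrow> 'w \<Rightarrow> real \<Rightarrow> 'a" where
  "sample_path T X \<omega> = restrict (\<lambda>t. X t \<omega>) {0..T}"

section \<open>Large deviation principles\<close>

definition borel_of :: "'a topology \<Rightarrow> 'a measure" where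
  "borel_of E = sigma (topspace E) {U. openin E U}"

definition log0 :: "real \<Rightarrow> ereal" where
  "log0 q = (if q > 0 then ereal (ln q) else -\<infinity>)"

definition rate_function :: "'a topology \<Rightarrow> ('a \<Rightarrow> ennreal) \<Rightarrow> bool" where
  "rate_function E I \<longleftrightarrow> (\<forall>a. closedin E {x \<in> topspace E. I x \<le> a})"

definition good_rate_function :: "'a topology \<Rightarrow> ('a \<Rightarrow> ennreal) \<Rightarrow> bool" where
  "good_rate_function E I \<longleftrightarrow> rate_function E I \<and>
     (\<forall>a::real. a \<ge> 0 \<longrightarrow> compactin E {x \<in> topspace E. I x \<le> ennreal a})"

definition speed :: "(nat \<Rightarrow> real) \<Rightarrow> bool" where
  "speed \<gamma> \<longleftrightarrow> (\<forall>n. \<gamma> n > 0) \<and> filterlim \<gamma> at_top sequentially"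

definition LDP :: "'a topology \<Rightarrow> (nat \<Rightarrow> 'a measure) \<Rightarrow> (nat \<Rightarrow> real) \<Rightarrow> ('a \<Rightarrow> ennreal) \<Rightarrow> bool" where
  "LDP E \<mu> \<gamma> I \<longleftrightarrow>
     (\<forall>n. prob_space (\<mu> n) \<and> sets (\<mu> n) = sets (borel_of E)) \<and>
     speed \<gamma> \<and> rate_function E I \<and>
     (\<forall>\<Theta>. openin E \<Theta> \<longrightarrow>
        liminf (\<lambda>n. ereal (1 / \<gamma> n) * log0 (measure (\<mu> n) \<Theta>)) \<ge> - enn2ereal (INF x\<in>\<Theta>. I x)) \<and>
     (\<forall>\<Gamma>. closedin E \<Gamma> \<longrightarrow>
        limsup (\<lambda>n. ereal (1 / \<gamma> n) * log0 (measure (\<mu> n) \<Gamma>)) \<le> - enn2ereal (INF x\<in>\<Gamma>. I x))"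

definition random_elements_LDP ::
    "'w measure \<Rightarrow> 'a topology \<Rightarrow> (nat \<Rightarrow> 'w \<Rightarrow> 'a) \<Rightarrow> (nat \<Rightarrow> real) \<Rightarrow> ('a \<Rightarrow> ennreal) \<Rightarrow> bool" where
  "random_elements_LDP M E Y \<gamma> I \<longleftrightarrow>
     (\<forall>n. Y n \<in> measurable M (borel_of E)) \<and> LDP E (\<lambda>n. distr M (borel_of E) (Y n)) \<gamma> I"

section \<open>Independence and Gaussian processes\<close>

text \<open>The library's \<open>indep_var\<close> requires both random elements to have the same value type.\<close>

definition indep_elements ::
    "'w measure \<Rightarrow> 'a measure \<Rightarrow> ('w \<Rightarrow> 'a) \<Rightarrow> 'b measure \<Rightarrow> ('w \<Rightarrow> 'b) \<Rightarrow> bool" where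
  "indep_elements M S Y S' Y' \<longleftrightarrow> Y \<in> measurable M S \<and> Y' \<in> measurable M S' \<and>
     prob_space.indep_set M (sets (vimage_algebra (space M) Y S)) (sets (vimage_algebra (space M) Y' S'))"

text \<open>Degenerate (almost surely zero) variables count as Gaussian.\<close>

definition centered_gaussian :: "'w measure \<Rightarrow> ('w \<Rightarrow> real) \<Rightarrow> bool" where
  "centered_gaussian M Y \<longleftrightarrow> Y \<in> borel_measurable M \<and>
     ((AE \<omega> in M. Y \<omega> = 0) \<or> (\<exists>\<sigma>>0. distributed M lborel Y (normal_density 0 \<sigma>)))"

definition centered_gaussian_process ::
    "'w measure \<Rightarrow> real \<Rightarrow> (real \<Rightarrow> 'w \<Rightarrow> 'a::euclidean_space) \<Rightarrow> bool" where
  "centered_gaussian_process M T X \<longleftrightarrow>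
     (\<forall>F c. finite F \<and> F \<subseteq> {0..T} \<longrightarrow> centered_gaussian M (\<lambda>\<omega>. \<Sum>t\<in>F. c t \<bullet> X t \<omega>))"

definition continuous_process ::
    "'w measure \<Rightarrow> real \<Rightarrow> (real \<Rightarrow> 'w \<Rightarrow> 'a::euclidean_space) \<Rightarrow> bool" where
  "continuous_process M T X \<longleftrightarrow> (\<forall>\<omega>\<in>space M. continuous_on {0..T} (\<lambda>t. X t \<omega>))"

section \<open>Reproducing kernel Hilbert spaces\<close>

text \<open>
  A signed measure on \<open>[0,T]\<close> is given by a Jordan decomposition, as a difference
  \<open>\<lambda>1 - \<lambda>2\<close> of two finite measures.
\<close>

definition finite_borel_measure_on :: "real \<Rightarrow> real measure \<Rightarrow> bool" where
  "finite_borel_measure_on T l \<longleftrightarrow> finite_measure l \<and> sets l = sets (restrict_space borel {0..T})"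

definition path_functionals :: "real \<Rightarrow> (real \<Rightarrow> 'v \<Rightarrow> real) \<Rightarrow> ('v \<Rightarrow> real) set" where
  "path_functionals T U =
     {\<lambda>\<omega>. (\<integral>t. U t \<omega> \<partial>l1) - (\<integral>t. U t \<omega> \<partial>l2) | l1 l2.
        finite_borel_measure_on T l1 \<and> finite_borel_measure_on T l2}"

text \<open>
  The \<open>L\<^sup>2\<close>-closure of the path functionals. Its elements are functions rather than classes
  modulo almost sure equality. The nonnegative integral takes the value \<open>\<infinity>\<close> on functions
  that are not square integrable.
\<close>

definition gaussian_space :: "'v measure \<Rightarrow> real \<Rightarrow> (real \<Rightarrow> 'v \<Rightarrow> real) \<Rightarrow> ('v \<Rightarrow> real) set" where
  "gaussian_space N T U =
     {Y \<in> borel_measurable N. integrable N (\<lambda>\<omega>. (Y \<omega>)\<^sup>2) \<and>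
        (\<forall>\<epsilon>>0. \<exists>V\<in>path_functionals T U.
           V \<in> borel_measurable N \<and> (\<integral>\<^sup>+\<omega>. ennreal ((Y \<omega> - V \<omega>)\<^sup>2) \<partial>N) < ennreal (\<epsilon>\<^sup>2))}"

definition rkhs_map :: "'v measure \<Rightarrow> real \<Rightarrow> (real \<Rightarrow> 'v \<Rightarrow> real) \<Rightarrow> ('v \<Rightarrow> real) \<Rightarrow> real \<Rightarrow> real" where
  "rkhs_map N T U Y = restrict (\<lambda>t. \<integral>\<omega>. U t \<omega> * Y \<omega> \<partial>N) {0..T}"

definition rkhs :: "'v measure \<Rightarrow> real \<Rightarrow> (real \<Rightarrow> 'v \<Rightarrow> real) \<Rightarrow> (real \<Rightarrow> real) set" where
  "rkhs N T U = rkhs_map N T U ` gaussian_space N T U"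

text \<open>
  \<open>rkhs_map\<close> is injective on \<open>gaussian_space\<close> up to almost sure equality, so the value of
  \<open>rkhs_inner\<close> does not depend on the preimages selected by \<open>inv_into\<close>.
\<close>

definition rkhs_inner ::
    "'v measure \<Rightarrow> real \<Rightarrow> (real \<Rightarrow> 'v \<Rightarrow> real) \<Rightarrow> (real \<Rightarrow> real) \<Rightarrow> (real \<Rightarrow> real) \<Rightarrow> real" where
  "rkhs_inner N T U g h =
     (\<integral>\<omega>. inv_into (gaussian_space N T U) (rkhs_map N T U) g \<omega> *
          inv_into (gaussian_space N T U) (rkhs_map N T U) h \<omega> \<partial>N)"

definition rkhs_norm :: "'v measure \<Rightarrow> real \<Rightarrow> (real \<Rightarrow> 'v \<Rightarrow> real) \<Rightarrow> (real \<Rightarrow> real) \<Rightarrow> real" where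
  "rkhs_norm N T U h = sqrt (rkhs_inner N T U h h)"

definition gaussian_rate :: "'v measure \<Rightarrow> real \<Rightarrow> (real \<Rightarrow> 'v \<Rightarrow> real) \<Rightarrow> (real \<Rightarrow> real) \<Rightarrow> ennreal" where
  "gaussian_rate N T U h =
     (if h \<in> rkhs N T U then ennreal (1/2 * (rkhs_norm N T U h)\<^sup>2) else \<infinity>)"

section \<open>The constant in the limit\<close>

definition \<psi> :: "real \<Rightarrow> real \<Rightarrow> real" where
  "\<psi> d \<theta> = 2 powr (\<theta> / (\<theta> + 2)) *
     (d * (d * \<theta>) powr (- (\<theta> / (\<theta> + 2))) + 1/2 * (d * \<theta>) powr (2 / (\<theta> + 2)))"

text \<open>Powers with positive exponent; quotients in \<^typ>\<open>ennreal\<close> satisfy \<open>a / 0 = \<infinity>\<close> for \<open>a > 0\<close>.\<close>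

definition epowr :: "ennreal \<Rightarrow> real \<Rightarrow> ennreal" where
  "epowr z a = (if z = \<infinity> then \<infinity> else ennreal (enn2real z powr a))"

end

theory Submission
  imports Defs
begin

text \<open>
  The components of \<open>A\<^sup>n\<close> and of \<open>X\<^sup>n\<close> are independent, so the probability in question is the product
  over \<open>i\<close> of the probabilities that the \<open>i\<close>-th component reaches its level
  (\<open>prob_components_mult\<close>). Its exponential decay rate is the sum of theirs, and the
  infimum of a sum whose terms depend on separate times is the sum of the infima
  (\<open>sum_INF_eq_INF_sum\<close>). One component remains to be understood.

  Put \<open>f = x - b > 0\<close> and let \<open>S\<close> be the maximum of \<open>X / f\<close> over \<open>[0,T]\<close>. Since \<open>A > 0\<close>, the path
  \<open>A X + b\<close> reaches the level \<open>x\<close> exactly when \<open>A S \<ge> 1\<close>, a statement about a product of two independent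
  variables. The tail \<open>P(A \<ge> a)\<close> decays at rate \<open>d a\<^sup>\<theta>\<close>. The tail \<open>P(S \<ge> s)\<close> decays at rate
  \<open>s\<^sup>2 \<kappa>\<close>, where \<open>\<kappa>\<close> is the infimum of \<open>f(t)\<^sup>2 / (2 k(t,t))\<close> over \<open>t\<close>
  (\<open>tendsto_decay_rate_boundary_crossing\<close>): in the reproducing kernel Hilbert space,
  evaluation at \<open>t\<close> is the inner product with \<open>k(\<cdot>,t)\<close>, so the cheapest
  path with \<open>h(t) = s f(t)\<close> is a multiple of \<open>k(\<cdot>,t)\<close>, of energy \<open>s\<^sup>2 f(t)\<^sup>2 / (2 k(t,t))\<close>
  (\<open>gaussian_rate_ge\<close> and \<open>gaussian_rate_cov\<close>).

  The product exceeds 1 most easily by \<open>A \<approx> a\<close> and \<open>S \<approx> 1/a\<close> with the best \<open>a\<close>, which costs the infimum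
  of \<open>d a\<^sup>\<theta> + \<kappa> / a\<^sup>2\<close>. A finite geometric grid in \<open>a\<close> is enough to see that nothing cheaper exists
  (\<open>tendsto_decay_rate_product\<close>). Calculus evaluates this infimum as \<open>\<psi>(d,\<theta>) \<kappa>\<close> with the
  power \<open>\<theta> / (\<theta> + 2)\<close> on \<open>\<kappa>\<close> (\<open>INF_trade_off_eq\<close>).

  The one analytic obstacle is that the norm entering the rate function is computed from some preimage of
  the path, picked by choice, under \<open>Y \<mapsto> E[U(\<cdot>) Y]\<close>. All preimages must be shown to have the same second
  moment. Two of them differ by a variable orthogonal to every \<open>U(t)\<close>, hence by Fubini to every
  functional \<open>\<integral> U d\<lambda>\<close>, hence to the whole \<open>L\<^sup>2\<close>-closure (\<open>orthogonal_gaussian_space\<close>). Fubini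
  needs bounded variances on \<open>[0,T]\<close>. These come from the fact that a centered Gaussian variable that
  is small with probability one half has small variance (\<open>centered_gaussian_small_variance\<close>).
\<close>

section \<open>Infima of extended nonnegative reals\<close>

text \<open>
  Multiplication by a positive constant is invertible on \<open>[0,\<infinity>]\<close>, which
  gives the inequality that monotonicity does not.
\<close>

lemma ennreal_mult_INF:
  fixes g :: "'a \<Rightarrow> ennreal"
  assumes "c > 0"
  shows "ennreal c * (INF t\<in>K. g t) = (INF t\<in>K. ennreal c * g t)"
proof (rule antisym)
  show "ennreal c * (INF t\<in>K. g t) \<le> (INF t\<in>K. ennreal c * g t)"
    by (intro INF_greatest mult_left_mono INF_lower) auto
  have cancel: "ennreal (1 / c) * (ennreal c * y) = y" "ennreal c * (ennreal (1 / c) * y) = y" for y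
    using assms by (simp_all add: mult.assoc[symmetric] flip: ennreal_mult)
  have "ennreal (1 / c) * (INF t\<in>K. ennreal c * g t) \<le> (INF t\<in>K. g t)"
  proof (rule INF_greatest)
    fix t assume "t \<in> K"
    hence "ennreal (1 / c) * (INF t\<in>K. ennreal c * g t) \<le> ennreal (1 / c) * (ennreal c * g t)"
      by (intro mult_left_mono INF_lower) auto
    thus "ennreal (1 / c) * (INF t\<in>K. ennreal c * g t) \<le> g t" by (simp only: cancel)
  qed
  from mult_left_mono[OF this, of "ennreal c"]
  show "(INF t\<in>K. ennreal c * g t) \<le> ennreal c * (INF t\<in>K. g t)" by (simp only: cancel zero_le)
qed

lemma ennreal_add_INF:
  fixes g :: "'a \<Rightarrow> ennreal"
  shows "ennreal c + (INF t\<in>K. g t) = (INF t\<in>K. ennreal c + g t)"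
proof (rule antisym)
  show "ennreal c + (INF t\<in>K. g t) \<le> (INF t\<in>K. ennreal c + g t)"
    by (intro INF_greatest add_left_mono INF_lower)
  have "(INF t\<in>K. ennreal c + g t) - ennreal c \<le> (INF t\<in>K. g t)"
  proof (rule INF_greatest)
    fix t assume "t \<in> K"
    hence "(INF t\<in>K. ennreal c + g t) \<le> ennreal c + g t" by (rule INF_lower)
    thus "(INF t\<in>K. ennreal c + g t) - ennreal c \<le> g t" by (simp add: ennreal_minus_le_iff)
  qed
  thus "(INF t\<in>K. ennreal c + g t) \<le> ennreal c + (INF t\<in>K. g t)"
    by (simp add: ennreal_minus_le_iff)
qed

lemma sum_INF_eq_INF_sum:
  fixes w :: "'i::finite \<Rightarrow> 'a \<Rightarrow> ennreal"
  shows "(\<Sum>i\<in>UNIV. INF t\<in>K. w i t) = (INF t\<in>{t. \<forall>i. t i \<in> K}. \<Sum>i\<in>UNIV. w i (t i))"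
proof (rule antisym)
  show "(\<Sum>i\<in>UNIV. INF t\<in>K. w i t) \<le> (INF t\<in>{t. \<forall>i. t i \<in> K}. \<Sum>i\<in>UNIV. w i (t i))"
    by (intro INF_greatest sum_mono INF_lower) auto
  show "(INF t\<in>{t. \<forall>i. t i \<in> K}. \<Sum>i\<in>UNIV. w i (t i)) \<le> (\<Sum>i\<in>UNIV. INF t\<in>K. w i t)"
  proof (rule ennreal_le_epsilon)
    fix e :: real
    assume fin: "(\<Sum>i\<in>UNIV. INF t\<in>K. w i t) < top" and e: "0 < e"
    define e' where "e' = e / CARD('i)"
    have e': "e' > 0" using e by (simp add: e'_def)
    have "\<exists>t\<in>K. w i t \<le> (INF t\<in>K. w i t) + ennreal e'" for i
    proof (rule ccontr)
      assume "\<not> ?thesis"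
      hence "(INF t\<in>K. w i t) + ennreal e' \<le> (INF t\<in>K. w i t)" by (intro INF_greatest) auto
      moreover have "(INF t\<in>K. w i t) < top"
        using fin by (auto simp: ennreal_sum_less_top)
      ultimately show False
        using e' ennreal_add_left_cancel_le[of "INF t\<in>K. w i t" "ennreal e'" 0] by auto
    qed
    then obtain t where t: "\<And>i. t i \<in> K" "\<And>i. w i (t i) \<le> (INF t\<in>K. w i t) + ennreal e'" by metis
    have "(INF t\<in>{t. \<forall>i. t i \<in> K}. \<Sum>i\<in>UNIV. w i (t i)) \<le> (\<Sum>i\<in>UNIV. w i (t i))"
      using t(1) by (intro INF_lower) auto
    also have "\<dots> \<le> (\<Sum>i\<in>UNIV. (INF t\<in>K. w i t) + ennreal e')" by (intro sum_mono t(2))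
    also have "\<dots> = (\<Sum>i\<in>UNIV. INF t\<in>K. w i t) + of_nat CARD('i) * ennreal e'"
      by (simp add: sum.distrib)
    also have "of_nat CARD('i) * ennreal e' = ennreal e"
      using e' by (simp add: e'_def ennreal_of_nat_eq_real_of_nat flip: ennreal_mult)
    finally show "(INF t\<in>{t. \<forall>i. t i \<in> K}. \<Sum>i\<in>UNIV. w i (t i)) \<le> (\<Sum>i\<in>UNIV. INF t\<in>K. w i t) + ennreal e" .
  qed
qed

section \<open>Exponential decay rates and large deviation principles\<close>

text \<open>
  The number \<open>- (1/g) log q\<close>, taken in \<open>[0,\<infinity>]\<close>: there
  addition is continuous, so the decay rate of a product of independent events converges to the
  sum of the limits with no indeterminate forms.
\<close>

definition decay_rate :: "real \<Rightarrow> real \<Rightarrow> ennreal" where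
  "decay_rate g q = (if q > 0 then ennreal (- ln q / g) else \<infinity>)"

lemma scaled_log0_eq_decay_rate:
  assumes "g > 0" "0 \<le> q" "q \<le> 1"
  shows "ereal (1 / g) * log0 q = - enn2ereal (decay_rate g q)"
proof (cases "q > 0")
  case True
  have "ln q \<le> 0" using assms True by simp
  hence "- ln q / g \<ge> 0" using assms by (simp add: divide_nonpos_pos)
  then show ?thesis using True assms by (simp add: decay_rate_def log0_def enn2ereal_ennreal)
next
  case False
  then show ?thesis using assms by (simp add: decay_rate_def log0_def)
qed

lemma less_decay_rate_iff:
  assumes "g > 0" "0 \<le> q" "q \<le> 1" "0 \<le> L"
  shows "ennreal L < decay_rate g q \<longleftrightarrow> q < exp (- (g * L))"
proof (cases "q > 0")
  case True
  have "q < exp (- (g * L)) \<longleftrightarrow> ln q < - (g * L)"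
    using True by (metis exp_less_cancel_iff exp_ln)
  also have "\<dots> \<longleftrightarrow> L < - ln q / g" using assms by (simp add: field_simps) linarith
  finally show ?thesis using True assms by (simp add: decay_rate_def ennreal_less_iff)
next
  case False
  hence "q = 0" using assms by simp
  then show ?thesis by (simp add: decay_rate_def)
qed

lemma decay_rate_mult:
  assumes "g > 0" "0 \<le> q" "q \<le> 1" "0 \<le> r" "r \<le> 1"
  shows "decay_rate g (q * r) = decay_rate g q + decay_rate g r"
proof (cases "q > 0 \<and> r > 0")
  case True
  have "- ln (q * r) / g = - ln q / g + - ln r / g"
    using True by (simp add: ln_mult diff_divide_distrib)
  moreover have "- ln q / g \<ge> 0" "- ln r / g \<ge> 0" using assms True by (simp_all add: divide_nonpos_pos)
  ultimately have "ennreal (- ln (q * r) / g) = ennreal (- ln q / g) + ennreal (- ln r / g)"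
    by (metis ennreal_plus)
  then show ?thesis using True by (simp add: decay_rate_def)
next
  case False
  then show ?thesis using assms by (auto simp: decay_rate_def zero_less_mult_iff)
qed

lemma decay_rate_1 [simp]: "decay_rate g 1 = 0"
  by (simp add: decay_rate_def)

lemma decay_rate_prod:
  assumes "g > 0" "finite I" "\<And>i. i \<in> I \<Longrightarrow> 0 \<le> q i \<and> q i \<le> 1"
  shows "decay_rate g (\<Prod>i\<in>I. q i) = (\<Sum>i\<in>I. decay_rate g (q i))"
  using assms(2,3)
proof (induction I rule: finite_induct)
  case (insert i I)
  have "0 \<le> prod q I" "prod q I \<le> 1" using insert by (auto intro!: prod_nonneg prod_le_1)
  then show ?case using insert assms(1) by (simp add: decay_rate_mult)
qed simp

lemma decay_rate_antimono:
  assumes "g > 0" "q \<le> r"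
  shows "decay_rate g r \<le> decay_rate g q"
proof (cases "q > 0")
  case True
  hence "ln q \<le> ln r" using assms by simp
  then show ?thesis using True assms by (auto simp: decay_rate_def intro!: ennreal_leI divide_right_mono)
qed (auto simp: decay_rate_def)

text \<open>
  The form in which large deviation principles are used: an open set inside a closed one, with
  rates that pinch \<open>J\<close>, makes the two one-sided bounds meet.
\<close>

lemma tendsto_decay_rate_LDP:
  assumes LDP: "random_elements_LDP M E Y \<gamma> I" and M: "prob_space M"
    and \<Theta>: "openin E \<Theta>" "(INF y\<in>\<Theta>. I y) \<le> J"
    and \<Gamma>: "closedin E \<Gamma>" "J \<le> (INF y\<in>\<Gamma>. I y)" and sub: "\<Theta> \<subseteq> \<Gamma>"
  shows "(\<lambda>n. decay_rate (\<gamma> n) (measure M {\<omega> \<in> space M. Y n \<omega> \<in> \<Gamma>})) \<longlonglongrightarrow> J"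
proof -
  interpret prob_space M by fact
  let ?B = "borel_of E"
  have space_B: "space ?B = topspace E" 
    unfolding borel_of_def by (rule space_measure_of) (auto dest: openin_subset)
  have opens: "U \<in> sets ?B" if "openin E U" for U
    
  proof -
    have "sets ?B = sigma_sets (topspace E) {U. openin E U}"
      unfolding borel_of_def by (rule sets_measure_of) (auto dest: openin_subset)
    thus ?thesis using that by auto
  qed
  have closeds: "C \<in> sets ?B" if "closedin E C" for C
  proof -
    have "topspace E - (topspace E - C) \<in> sets ?B"
      using that opens space_B by (metis closedin_def sets.compl_sets)
    thus ?thesis using that closedin_subset by (metis double_diff order_refl)
  qed
  have Y: "Y n \<in> measurable M ?B" for n
    using LDP by (simp add: random_elements_LDP_def)
  have distr: "measure (distr M ?B (Y n)) C = prob {\<omega> \<in> space M. Y n \<omega> \<in> C}" if "C \<in> sets ?B" for C n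
    using measure_distr[OF Y that] by (simp add: vimage_def Int_def conj_commute)
  have \<gamma>: "\<gamma> n > 0" for n
    using LDP by (simp add: random_elements_LDP_def LDP_def speed_def)
  let ?p = "\<lambda>C n. prob {\<omega> \<in> space M. Y n \<omega> \<in> C}"
  let ?l = "\<lambda>C n. ereal (1 / \<gamma> n) * log0 (?p C n)"
  have l_eq: "?l C n = - enn2ereal (decay_rate (\<gamma> n) (?p C n))" for C n
    by (rule scaled_log0_eq_decay_rate) (auto simp: \<gamma>)
  have "liminf (?l \<Theta>) \<ge> - enn2ereal (INF y\<in>\<Theta>. I y)"
    unfolding distr[OF opens[OF \<Theta>(1)], symmetric]
    using LDP \<Theta>(1) by (simp add: random_elements_LDP_def LDP_def)
  moreover have "- enn2ereal J \<le> - enn2ereal (INF y\<in>\<Theta>. I y)"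
    using \<Theta>(2) by (simp add: less_eq_ennreal.rep_eq)
  moreover have "liminf (?l \<Theta>) \<le> liminf (?l \<Gamma>)"
  proof (intro Liminf_mono always_eventually allI)
    fix n
    have "{\<omega> \<in> space M. Y n \<omega> \<in> \<Gamma>} \<in> events"
      using measurable_sets[OF Y closeds[OF \<Gamma>(1)]] by (simp add: vimage_def Int_def conj_commute)
    hence "?p \<Theta> n \<le> ?p \<Gamma> n" using sub by (intro finite_measure_mono) auto
    thus "?l \<Theta> n \<le> ?l \<Gamma> n"
      unfolding l_eq using decay_rate_antimono[OF \<gamma>] by (simp add: less_eq_ennreal.rep_eq)
  qed
  ultimately have lower: "- enn2ereal J \<le> liminf (?l \<Gamma>)" by (meson order.trans)
  have "limsup (?l \<Gamma>) \<le> - enn2ereal (INF y\<in>\<Gamma>. I y)"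
    unfolding distr[OF closeds[OF \<Gamma>(1)], symmetric]
    using LDP \<Gamma>(1) by (simp add: random_elements_LDP_def LDP_def)
  also have "\<dots> \<le> - enn2ereal J"
    using \<Gamma>(2) by (simp add: less_eq_ennreal.rep_eq)
  finally have upper: "limsup (?l \<Gamma>) \<le> - enn2ereal J" .
  have "?l \<Gamma> \<longlonglongrightarrow> - enn2ereal J"
    using lower upper Liminf_le_Limsup[of sequentially "?l \<Gamma>"]
    by (auto intro!: Liminf_eq_Limsup)
  hence "(\<lambda>n. - ?l \<Gamma> n) \<longlonglongrightarrow> - (- enn2ereal J)" by (intro tendsto_intros)
  hence "(\<lambda>n. enn2ereal (decay_rate (\<gamma> n) (?p \<Gamma> n))) \<longlonglongrightarrow> enn2ereal J" by (simp add: l_eq)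
  thus ?thesis by (simp add: tendsto_enn2ereal_iff)
qed

text \<open>
  The rate is increasing and continuous, so its infima over \<open>[a,\<infinity>)\<close> and
  over \<open>(a,\<infinity>)\<close> agree.
\<close>

lemma tendsto_decay_rate_power_tail:
  assumes LDP: "random_elements_LDP M (top_of_set {0..}) A \<gamma> (\<lambda>a. ennreal (d * a powr \<theta>))"
    and M: "prob_space M" and d: "d > 0" and \<theta>: "\<theta> > 0" and a: "a > 0"
  shows "(\<lambda>n. decay_rate (\<gamma> n) (measure M {\<omega> \<in> space M. a \<le> A n \<omega>})) \<longlonglongrightarrow> ennreal (d * a powr \<theta>)"
proof -
  let ?I = "\<lambda>a. ennreal (d * a powr \<theta>)"
  have "?I a \<le> (INF y\<in>{a..}. ?I y)"
    using a d \<theta> by (intro INF_greatest ennreal_leI mult_left_mono powr_mono2) auto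
  moreover have "(INF y\<in>{a<..}. ?I y) \<le> ?I a"
  proof (rule tendsto_lowerbound)
    show "(?I \<longlongrightarrow> ?I a) (at_right a)"
      using a by (intro tendsto_ennrealI tendsto_intros) auto
    have "\<forall>\<^sub>F y in at_right a. y > a" by (simp add: eventually_at_filter)
    thus "\<forall>\<^sub>F y in at_right a. (INF y\<in>{a<..}. ?I y) \<le> ?I y"
      by eventually_elim (auto intro: INF_lower)
  qed simp
  moreover have "openin (top_of_set {0..}) {a<..}" using a by (intro open_subset) auto
  moreover have "closedin (top_of_set {0..}) {a..}" using a by (intro closed_subset) auto
  ultimately have "(\<lambda>n. decay_rate (\<gamma> n) (measure M {\<omega> \<in> space M. A n \<omega> \<in> {a..}})) \<longlonglongrightarrow> ?I a"
    by (intro tendsto_decay_rate_LDP[OF LDP M]) auto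
  thus ?thesis by simp
qed

section \<open>The trade-off between factor and process\<close>

text \<open>
  Young's inequality in logarithmic coordinates: the two tangents at \<open>v = 0\<close> have
  slopes \<open>2\<close> and \<open>-2\<close>, which cancel.
\<close>

lemma exponential_young:
  fixes \<theta> v :: real
  assumes "\<theta> > 0"
  shows "1 + 2 / \<theta> \<le> 2 / \<theta> * exp (\<theta> * v) + exp (- (2 * v))"
proof -
  have "2 / \<theta> * exp (\<theta> * v) \<ge> 2 / \<theta> * (1 + \<theta> * v)"
    using assms by (intro mult_left_mono exp_ge_add_one_self) auto
  moreover have "2 / \<theta> * (1 + \<theta> * v) = 2 / \<theta> + 2 * v" using assms by (simp add: field_simps)
  moreover have "exp (- (2 * v)) \<ge> 1 - 2 * v" using exp_ge_add_one_self[of "- (2 * v)"] by simp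
  ultimately show ?thesis by linarith
qed

text \<open>
  The critical point \<open>a0\<close> of \<open>d a\<^sup>\<theta> + z / a\<^sup>2\<close>
  solves \<open>a\<^bsup>\<theta>+2\<^esup> = 2 z / (d \<theta>)\<close>. At \<open>a0\<close>
  the first summand is \<open>2/\<theta>\<close> times the second, so after writing \<open>a =
  a0 exp v\<close> global minimality is \<open>exponential_young\<close>.
\<close>

lemma \<psi>_minimum:
  fixes d \<theta> z :: real
  assumes "d > 0" "\<theta> > 0" "z > 0"
  defines "a0 \<equiv> (2 * z / (d * \<theta>)) powr (1 / (\<theta> + 2))"
  shows "d * a0 powr \<theta> + z / a0\<^sup>2 = \<psi> d \<theta> * z powr (\<theta> / (\<theta> + 2))" (is ?eq)
    and "a > 0 \<Longrightarrow> \<psi> d \<theta> * z powr (\<theta> / (\<theta> + 2)) \<le> d * a powr \<theta> + z / a\<^sup>2"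
proof -
  define e where "e = d * \<theta>"
  have e: "e > 0" using assms by (simp add: e_def)
  have a0: "a0 > 0" using assms by (simp add: a0_def)
  define r where "r = \<theta> / (\<theta> + 2)"
  have r1: "2 / (\<theta> + 2) = 1 - r" "1 / (\<theta> + 2) * \<theta> = r" "1 / (\<theta> + 2) * 2 = 1 - r"
    using assms by (simp_all add: r_def field_simps)
  have pow: "a0 powr \<theta> = 2 powr r * z powr r * e powr (- r)"
    using assms e by (simp add: a0_def powr_powr powr_mult powr_divide powr_minus_divide flip: e_def r_def)
  have "a0\<^sup>2 = a0 powr 2" using a0 by simp
  also have "\<dots> = 2 powr (1 - r) * z powr (1 - r) / e powr (1 - r)"
    using assms e by (simp add: a0_def r1 powr_powr powr_mult powr_divide powr_minus_divide del: powr_numeral flip: e_def r_def)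
  finally have sq: "a0\<^sup>2 = 2 powr (1 - r) * z powr (1 - r) / e powr (1 - r)" .
  have "z / a0\<^sup>2 = 2 powr r / 2 * z powr r * e powr (1 - r)"
    unfolding sq using assms e by (simp add: powr_diff powr_minus field_simps)
  moreover have "\<psi> d \<theta> = 2 powr r * (d * e powr (- r) + 1 / 2 * e powr (1 - r))"
    unfolding \<psi>_def e_def r1(1)[symmetric] by (simp add: r_def)
  ultimately show eq: ?eq
    unfolding pow r_def[symmetric] by (simp add: algebra_simps)
  show "\<psi> d \<theta> * z powr (\<theta> / (\<theta> + 2)) \<le> d * a powr \<theta> + z / a\<^sup>2" if a: "a > 0"
  proof -
    define v where "v = ln (a / a0)"
    have a_eq: "a = a0 * exp v" using a a0 by (simp add: v_def)
    have crit: "d * a0 powr \<theta> = z / a0\<^sup>2 * (2 / \<theta>)"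
    proof -
      have "\<theta> * (d * a0 powr \<theta>) * a0\<^sup>2 = 2 * z"
        unfolding pow sq using assms e by (simp add: powr_diff powr_minus e_def field_simps)
      hence crit': "\<theta> * (d * a0 powr \<theta>) = 2 * z / a0\<^sup>2"
        using a0 by (intro eq_divide_imp) simp_all
      have "d * a0 powr \<theta> = \<theta> * (d * a0 powr \<theta>) / \<theta>" using \<open>\<theta> > 0\<close> by simp
      thus ?thesis unfolding crit' by simp
    qed
    have "d * a powr \<theta> + z / a\<^sup>2 = d * a0 powr \<theta> * exp (\<theta> * v) + z / a0\<^sup>2 * exp (- (2 * v))"
    proof -
      have "exp v powr \<theta> = exp (\<theta> * v)" by (simp add: powr_def)
      moreover have "(exp v)\<^sup>2 = exp (2 * v)" by (simp flip: exp_of_nat_mult)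
      ultimately show ?thesis
        using a0 by (simp add: a_eq powr_mult power_mult_distrib exp_minus field_simps)
    qed
    also have "\<dots> = z / a0\<^sup>2 * (2 / \<theta> * exp (\<theta> * v) + exp (- (2 * v)))"
      unfolding crit by (simp only: distrib_left mult.assoc)
    also have "\<dots> \<ge> z / a0\<^sup>2 * (1 + 2 / \<theta>)"
      using assms by (intro mult_left_mono exponential_young) auto
    also have "z / a0\<^sup>2 * (1 + 2 / \<theta>) = d * a0 powr \<theta> + z / a0\<^sup>2"
      unfolding crit by (simp add: distrib_left)
    finally show ?thesis using eq by simp
  qed
qed

lemma \<psi>_nonneg: "d > 0 \<Longrightarrow> 0 \<le> \<psi> d \<theta>"
  by (simp add: \<psi>_def)

lemma \<psi>_pos: "d > 0 \<Longrightarrow> \<theta> > 0 \<Longrightarrow> 0 < \<psi> d \<theta>"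
  by (auto simp: \<psi>_def intro!: mult_pos_pos add_pos_pos)

text \<open>
  For \<open>z = \<infinity>\<close> both sides are infinite, because \<open>\<psi> d \<theta> >
  0\<close>.
\<close>

lemma INF_trade_off_eq:
  assumes "d > 0" "\<theta> > 0" "z > 0"
  shows "(INF a\<in>{0<..}. ennreal (d * a powr \<theta>) + ennreal ((1 / a)\<^sup>2) * z) =
           ennreal (\<psi> d \<theta>) * epowr z (\<theta> / (\<theta> + 2))"
    (is "(INF a\<in>_. ?f a) = ?w")
proof (cases "z = \<infinity>")
  case True
  have f: "?f a = \<infinity>" if "a \<in> {0<..}" for a
    using that True by (simp add: ennreal_mult_top)
  have "(INF a\<in>{0<..}. ?f a) = (INF a\<in>{0<..}::real set. \<infinity>)"
    by (intro INF_cong f refl)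
  also have "\<dots> = ?w"
    using True \<psi>_pos[OF assms(1,2)] by (simp add: epowr_def ennreal_mult_top)
  finally show ?thesis .
next
  case False
  then obtain y where y: "z = ennreal y" "y > 0"
    using assms by (cases z) fastforce+
  have f: "?f a = ennreal (d * a powr \<theta> + y / a\<^sup>2)" if "a > 0" for a
    using that assms y by (simp add: power_divide flip: ennreal_mult ennreal_plus)
  have w: "?w = ennreal (\<psi> d \<theta> * y powr (\<theta> / (\<theta> + 2)))"
    using y \<psi>_nonneg[OF assms(1)] by (simp add: epowr_def ennreal_mult)
  show ?thesis
  proof (intro antisym)
    define a0 where "a0 = (2 * y / (d * \<theta>)) powr (1 / (\<theta> + 2))"
    have "a0 > 0" using assms y by (simp add: a0_def)
    thus "(INF a\<in>{0<..}. ?f a) \<le> ?w"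
      using \<psi>_minimum(1)[OF assms(1,2) y(2)] by (intro INF_lower2[of a0]) (simp_all add: f w a0_def)
    show "?w \<le> (INF a\<in>{0<..}. ?f a)"
      using \<psi>_minimum(2)[OF assms(1,2) y(2)] by (intro INF_greatest) (simp add: f w ennreal_leI)
  qed
qed

text \<open>
  Exchanging the two infima avoids the continuity of the power at the infimum of
  \<open>g\<close>.
\<close>

lemma INF_trade_off_INF_eq:
  assumes d: "d > 0" and \<theta>: "\<theta> > 0" and g: "\<And>t. t \<in> K \<Longrightarrow> g t > 0"
  shows "(INF a\<in>{0<..}. ennreal (d * a powr \<theta>) + ennreal ((1 / a)\<^sup>2) * (INF t\<in>K. g t)) =
           (INF t\<in>K. ennreal (\<psi> d \<theta>) * epowr (g t) (\<theta> / (\<theta> + 2)))"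
proof -
  have "(INF a\<in>{0<..}. ennreal (d * a powr \<theta>) + ennreal ((1 / a)\<^sup>2) * (INF t\<in>K. g t)) =
      (INF a\<in>{0<..}. INF t\<in>K. ennreal (d * a powr \<theta>) + ennreal ((1 / a)\<^sup>2) * g t)"
    by (intro INF_cong refl) (simp add: ennreal_mult_INF ennreal_add_INF)
  also have "\<dots> = (INF t\<in>K. INF a\<in>{0<..}. ennreal (d * a powr \<theta>) + ennreal ((1 / a)\<^sup>2) * g t)"
    by (rule INF_commute)
  also have "\<dots> = (INF t\<in>K. ennreal (\<psi> d \<theta>) * epowr (g t) (\<theta> / (\<theta> + 2)))"
    using g by (intro INF_cong refl INF_trade_off_eq d \<theta>)
  finally show ?thesis .
qed

section \<open>Decay rate of a product of independent variables\<close>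

text \<open>
  For the probability from below, \<open>A \<ge> a\<close> and \<open>S \<ge> 1/a\<close>
  together force \<open>A S \<ge> 1\<close>, for each \<open>a\<close>. For the probability from
  above, cover \<open>A S \<ge> 1\<close> by finitely many events: \<open>S \<ge> 1/r\<close>,
  needed when \<open>A \<le> r\<close>; \<open>A \<ge> r \<rho>\<^sup>m\<close>; and, for each
  cell of the grid \<open>r \<rho>\<^sup>j\<close>, the event that \<open>A\<close> is above the
  left end of the cell and \<open>S\<close> above the reciprocal of its right end. A finite
  union has the largest of the probabilities up to a constant factor, which disappears on the
  exponential scale. Replacing \<open>1/a\<close> by \<open>1/(\<rho> a)\<close> lowers the cost
  at most by the factor \<open>\<rho>\<^sup>2\<close>, which can be taken as close to 1 as
  desired.
\<close>

lemma tendsto_decay_rate_product: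
  fixes A S :: "nat \<Rightarrow> 'w \<Rightarrow> real"
  assumes M: "prob_space M" and \<gamma>: "speed \<gamma>" and d: "d > 0" and \<theta>: "\<theta> > 0"
    and A [measurable]: "\<And>n. A n \<in> borel_measurable M"
    and S [measurable]: "\<And>n. S n \<in> borel_measurable M"
    and pos: "\<And>n \<omega>. \<omega> \<in> space M \<Longrightarrow> A n \<omega> > 0"
    and indep: "\<And>n a s. measure M {\<omega> \<in> space M. A n \<omega> \<ge> a \<and> S n \<omega> \<ge> s} =
       measure M {\<omega> \<in> space M. A n \<omega> \<ge> a} * measure M {\<omega> \<in> space M. S n \<omega> \<ge> s}"
    and lim_A: "\<And>a. a > 0 \<Longrightarrow>
       (\<lambda>n. decay_rate (\<gamma> n) (measure M {\<omega> \<in> space M. A n \<omega> \<ge> a})) \<longlonglongrightarrow> ennreal (d * a powr \<theta>)"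
    and lim_S: "\<And>s. s > 0 \<Longrightarrow>
       (\<lambda>n. decay_rate (\<gamma> n) (measure M {\<omega> \<in> space M. S n \<omega> \<ge> s})) \<longlonglongrightarrow> ennreal (s\<^sup>2) * \<kappa>"
  shows "(\<lambda>n. decay_rate (\<gamma> n) (measure M {\<omega> \<in> space M. A n \<omega> * S n \<omega> \<ge> 1})) \<longlonglongrightarrow>
    (INF a\<in>{0<..}. ennreal (d * a powr \<theta>) + ennreal ((1 / a)\<^sup>2) * \<kappa>)"
    (is "_ \<longlonglongrightarrow> ?W")
proof -
  interpret prob_space M by fact
  have g: "\<gamma> n > 0" for n using \<gamma> by (simp add: speed_def)
  let ?P = "\<lambda>n. prob {\<omega> \<in> space M. A n \<omega> * S n \<omega> \<ge> 1}"
  let ?Q = "\<lambda>n a s. prob {\<omega> \<in> space M. A n \<omega> \<ge> a \<and> S n \<omega> \<ge> s}"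
  let ?w = "\<lambda>a s. ennreal (d * a powr \<theta>) + ennreal (s\<^sup>2) * \<kappa>"
  have lim_Q: "(\<lambda>n. decay_rate (\<gamma> n) (?Q n a s)) \<longlonglongrightarrow> ?w a s" if "a > 0" "s > 0" for a s
    unfolding indep using that
    by (subst decay_rate_mult) (auto simp: g intro!: tendsto_add lim_A lim_S)
  show ?thesis
  proof (rule order_tendstoI)
    fix u assume "?W < u"
    then obtain a where a: "a > 0" "?w a (1 / a) < u" by (auto simp: INF_less_iff)
    have "decay_rate (\<gamma> n) (?P n) \<le> decay_rate (\<gamma> n) (?Q n a (1 / a))" for n
    proof (intro decay_rate_antimono g finite_measure_mono subsetI)
      fix \<omega> assume "\<omega> \<in> {\<omega> \<in> space M. A n \<omega> \<ge> a \<and> S n \<omega> \<ge> 1 / a}"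
      moreover from this have "a * (1 / a) \<le> A n \<omega> * S n \<omega>" using a by (intro mult_mono) auto
      ultimately show "\<omega> \<in> {\<omega> \<in> space M. A n \<omega> * S n \<omega> \<ge> 1}" using a by simp
    qed measurable
    moreover have "\<forall>\<^sub>F n in sequentially. decay_rate (\<gamma> n) (?Q n a (1 / a)) < u"
      using a by (intro order_tendstoD(2)[OF lim_Q]) auto
    ultimately show "\<forall>\<^sub>F n in sequentially. decay_rate (\<gamma> n) (?P n) < u"
      by (auto elim!: eventually_mono intro: le_less_trans)
  next
    fix l assume "l < ?W"
    obtain l1 where l1: "l < l1" "l1 < ?W" using dense[OF \<open>l < ?W\<close>] by auto
    obtain l2 where l2: "l1 < l2" "l2 < ?W" using dense[OF l1(2)] by auto
    obtain L where L: "l = ennreal L" "L \<ge> 0" using l1 by (cases l) auto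
    obtain L1 where L1: "l1 = ennreal L1" "L1 > L" using l1 l2 L by (cases l1) (auto simp: ennreal_less_iff)
    obtain L2 where L2: "l2 = ennreal L2" "L2 > L1" using l2 L1 L by (cases l2) (auto simp: ennreal_less_iff)
    have W_gt: "ennreal L2 < ?w a (1 / a)" if "a > 0" for a
      using l2 L2 that by (auto intro: less_le_trans INF_lower)
    \<comment> \<open>the grid ratio \<open>\<rho>\<close> loses a factor \<open>\<rho>\<^sup>2\<close>, chosen as the ratio of \<open>L2\<close> to \<open>L1\<close>\<close>
    define \<rho> where "\<rho> = sqrt (L2 / L1)"
    have \<rho>: "\<rho> > 1" "\<rho>\<^sup>2 = L2 / L1" using L L1 L2 by (auto simp: \<rho>_def)
    have cell: "ennreal L1 < ?w a (1 / (\<rho> * a))" if "a > 0" for a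
    proof -
      have "ennreal (\<rho>\<^sup>2) * ennreal L1 = ennreal L2"
        using \<rho> L L1 L2 by (simp flip: ennreal_mult)
      also have "ennreal L2 < ?w a (1 / a)" by (rule W_gt[OF that])
      also have "\<dots> \<le> ennreal (\<rho>\<^sup>2) * ?w a (1 / (\<rho> * a))"
      proof -
        have "ennreal ((1 / a)\<^sup>2) = ennreal (\<rho>\<^sup>2) * ennreal ((1 / (\<rho> * a))\<^sup>2)"
          using \<rho>(1) that by (simp add: power_divide power_mult_distrib flip: ennreal_mult)
        moreover have "ennreal (d * a powr \<theta>) \<le> ennreal (\<rho>\<^sup>2) * ennreal (d * a powr \<theta>)"
        proof -
          have "1 * (d * a powr \<theta>) \<le> \<rho>\<^sup>2 * (d * a powr \<theta>)"
            using d \<rho>(1) by (intro mult_right_mono) auto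
          thus ?thesis using d by (simp add: ennreal_leI flip: ennreal_mult)
        qed
        ultimately show ?thesis by (simp add: distrib_left mult.assoc add_right_mono)
      qed
      finally have "ennreal (\<rho>\<^sup>2) * ennreal L1 < ennreal (\<rho>\<^sup>2) * ?w a (1 / (\<rho> * a))" .
      thus ?thesis by (meson leD leI mult_left_mono zero_le)
    qed
    \<comment> \<open>\<open>r\<close> is so small that \<open>A = r\<close> costs only \<open>L2 - L1\<close>. As the total cost at \<open>r\<close> exceeds \<open>L2\<close>, the
      event \<open>S \<ge> 1/r\<close> alone costs more than \<open>L1\<close>.\<close>
    define r where "r = ((L2 - L1) / d) powr (1 / \<theta>)"
    have r: "r > 0" using L2 d by (simp add: r_def)
    have r_pow: "d * r powr \<theta> = L2 - L1" using L2 d \<theta> by (simp add: r_def powr_powr)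
    have S_gt: "ennreal L1 < ennreal ((1 / r)\<^sup>2) * \<kappa>"
    proof (rule ccontr)
      assume "\<not> ?thesis"
      hence "?w r (1 / r) \<le> ennreal (L2 - L1) + ennreal L1"
        unfolding r_pow by (intro add_left_mono) simp
      also have "\<dots> = ennreal L2" using L L1 L2 by (simp flip: ennreal_plus)
      finally show False using W_gt[OF r] by simp
    qed
    define R where "R = ((L1 + 1) / d) powr (1 / \<theta>)"
    have R: "d * R powr \<theta> > L1" "R > 0"
      using L L1 d \<theta> by (auto simp: R_def powr_powr)
    obtain m where m: "R / r < \<rho> ^ m" using real_arch_pow[OF \<rho>(1)] by auto
    have A_gt: "ennreal L1 < ennreal (d * (r * \<rho> ^ m) powr \<theta>)"
    proof -
      have "R powr \<theta> \<le> (r * \<rho> ^ m) powr \<theta>"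
        using m r R \<theta> by (intro powr_mono2) (auto simp: field_simps)
      hence "L1 < d * (r * \<rho> ^ m) powr \<theta>"
        using R(1) d by (smt (verit) mult_left_mono)
      thus ?thesis using L L1 by (simp add: ennreal_less_iff)
    qed
    let ?a = "\<lambda>j. r * \<rho> ^ j"
    let ?low = "\<lambda>n. prob {\<omega> \<in> space M. S n \<omega> \<ge> 1 / r}"
    let ?high = "\<lambda>n. prob {\<omega> \<in> space M. A n \<omega> \<ge> ?a m}"
    let ?cell = "\<lambda>n j. ?Q n (?a j) (1 / (\<rho> * ?a j))"
    have a_pos: "?a j > 0" for j using r \<rho>(1) by simp
    have cover: "?P n \<le> ?low n + ?high n + (\<Sum>j<m. ?cell n j)" for n
    proof -
      let ?C = "\<lambda>j. {\<omega> \<in> space M. A n \<omega> \<ge> ?a j \<and> S n \<omega> \<ge> 1 / (\<rho> * ?a j)}"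
      let ?L = "{\<omega> \<in> space M. S n \<omega> \<ge> 1 / r}" and ?H = "{\<omega> \<in> space M. A n \<omega> \<ge> ?a m}"
      have sub: "{\<omega> \<in> space M. A n \<omega> * S n \<omega> \<ge> 1} \<subseteq> ?L \<union> ?H \<union> (\<Union>j<m. ?C j)"
      proof
        fix \<omega> assume "\<omega> \<in> {\<omega> \<in> space M. A n \<omega> * S n \<omega> \<ge> 1}"
        hence \<omega>: "\<omega> \<in> space M" "A n \<omega> * S n \<omega> \<ge> 1" by auto
        note pos = pos[OF \<omega>(1), of n]
        have bound: "S n \<omega> \<ge> 1 / b" if "A n \<omega> \<le> b" for b
        proof -
          have "1 / b \<le> 1 / A n \<omega>" using that pos by (intro divide_left_mono) auto
          also have "\<dots> \<le> S n \<omega>" using \<omega>(2) pos by (simp add: field_simps)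
          finally show ?thesis .
        qed
        show "\<omega> \<in> ?L \<union> ?H \<union> (\<Union>j<m. ?C j)"
        proof (cases "A n \<omega> \<le> r \<or> A n \<omega> \<ge> ?a m")
          case True
          then show ?thesis using \<omega>(1) bound by auto
        next
          case False
          hence not0: "A n \<omega> > ?a 0" and lt: "A n \<omega> < ?a m" by auto
          define i where "i = (LEAST i. A n \<omega> < ?a i)"
          have i: "A n \<omega> < ?a i" unfolding i_def using lt by (rule LeastI)
          have "i \<le> m" unfolding i_def using lt by (rule Least_le)
          have "i \<noteq> 0" using not0 i by (intro notI) auto
          then obtain j where j: "i = Suc j" by (cases i) auto
          have "A n \<omega> \<ge> ?a j" using not_less_Least[of j "\<lambda>i. A n \<omega> < ?a i"] j unfolding i_def by auto
          moreover have "A n \<omega> \<le> \<rho> * ?a j" using i by (simp add: j algebra_simps)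
          ultimately show ?thesis using \<omega>(1) bound j \<open>i \<le> m\<close> by fastforce
        qed
      qed
      have "?P n \<le> prob (?L \<union> ?H \<union> (\<Union>j<m. ?C j))"
        by (intro finite_measure_mono[OF sub]) measurable
      also have "\<dots> \<le> prob (?L \<union> ?H) + prob (\<Union>j<m. ?C j)"
        by (intro measure_Un_le) measurable
      also have "prob (?L \<union> ?H) \<le> ?low n + ?high n" by (intro measure_Un_le) measurable
      also have "prob (\<Union>j<m. ?C j) \<le> (\<Sum>j<m. ?cell n j)" by (intro measure_UNION_le) auto
      finally show ?thesis by simp
    qed
    define e where "e = (\<lambda>n. exp (- (\<gamma> n * L1)))"
    have "\<forall>\<^sub>F n in sequentially. ennreal L1 < decay_rate (\<gamma> n) (?low n)"
      using r by (intro order_tendstoD(1)[OF lim_S S_gt]) auto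
    moreover have "\<forall>\<^sub>F n in sequentially. ennreal L1 < decay_rate (\<gamma> n) (?high n)"
      using a_pos by (intro order_tendstoD(1)[OF lim_A A_gt]) auto
    moreover have "\<forall>\<^sub>F n in sequentially. \<forall>j\<in>{..<m}. ennreal L1 < decay_rate (\<gamma> n) (?cell n j)"
      using a_pos \<rho>(1) r by (intro eventually_ball_finite ballI order_tendstoD(1)[OF lim_Q cell]) auto
    \<comment> \<open>the gap between \<open>L\<close> and \<open>L1\<close> absorbs the number \<open>m + 2\<close> of covering events\<close>
    moreover have "\<forall>\<^sub>F n in sequentially. ln (real m + 2) / (L1 - L) < \<gamma> n"
      using \<gamma> by (simp add: speed_def filterlim_at_top_dense)
    ultimately show "\<forall>\<^sub>F n in sequentially. l < decay_rate (\<gamma> n) (?P n)"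
    proof eventually_elim
      case (elim n)
      have L1': "L1 \<ge> 0" using L L1 by simp
      have "?P n < e n + e n + (\<Sum>j<m. e n)"
        using elim cover[of n] less_decay_rate_iff[OF g _ _ L1', of _ n]
        by (intro le_less_trans[OF cover] add_less_le_mono add_strict_mono sum_mono less_imp_le)
           (auto simp: e_def)
      also have "\<dots> = (real m + 2) * e n" by (simp add: algebra_simps)
      also have "\<dots> = exp (ln (real m + 2)) * e n" by simp
      also have "\<dots> \<le> exp (- (\<gamma> n * L))"
      proof -
        have "ln (real m + 2) \<le> \<gamma> n * (L1 - L)" using elim(4) L1 by (simp add: field_simps)
        thus ?thesis
          unfolding e_def exp_add[symmetric] exp_le_cancel_iff by (simp add: algebra_simps)
      qed
      finally show ?case using less_decay_rate_iff[OF g _ _ L(2)] L(1) by simp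
    qed
  qed
qed

section \<open>Square-integrable functions and centered Gaussian variables\<close>

lemma integrable_mult_of_square_integrable:
  fixes f g :: "'a \<Rightarrow> real"
  assumes [measurable]: "f \<in> borel_measurable M" "g \<in> borel_measurable M"
    and f: "integrable M (\<lambda>x. (f x)\<^sup>2)" and g: "integrable M (\<lambda>x. (g x)\<^sup>2)"
  shows "integrable M (\<lambda>x. f x * g x)"
proof (rule Bochner_Integration.integrable_bound)
  show "integrable M (\<lambda>x. (f x)\<^sup>2 + (g x)\<^sup>2)" using f g by simp
  have "\<bar>a * b\<bar> \<le> a\<^sup>2 + b\<^sup>2" for a b :: real
  proof -
    have "0 \<le> \<bar>a\<bar> * \<bar>b\<bar>" by simp
    moreover have "2 * (\<bar>a\<bar> * \<bar>b\<bar>) \<le> a\<^sup>2 + b\<^sup>2"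
      using sum_squares_bound[of "\<bar>a\<bar>" "\<bar>b\<bar>"] by (simp add: mult.assoc)
    ultimately show ?thesis unfolding abs_mult by linarith
  qed
  thus "AE x in M. norm (f x * g x) \<le> norm ((f x)\<^sup>2 + (g x)\<^sup>2)" by simp
qed measurable

text \<open>
  The quadratic polynomial \<open>r \<mapsto> \<integral> (f + r g)\<^sup>2\<close> is
  nonnegative.
\<close>

lemma Cauchy_Schwarz_lebesgue:
  fixes f g :: "'a \<Rightarrow> real"
  assumes [measurable]: "f \<in> borel_measurable M" "g \<in> borel_measurable M"
    and f: "integrable M (\<lambda>x. (f x)\<^sup>2)" and g: "integrable M (\<lambda>x. (g x)\<^sup>2)"
  shows "(\<integral>x. f x * g x \<partial>M)\<^sup>2 \<le> (\<integral>x. (f x)\<^sup>2 \<partial>M) * (\<integral>x. (g x)\<^sup>2 \<partial>M)"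
proof -
  note fg = integrable_mult_of_square_integrable[OF assms]
  define F B G where "F = (\<integral>x. (f x)\<^sup>2 \<partial>M)" and "B = (\<integral>x. f x * g x \<partial>M)" and "G = (\<integral>x. (g x)\<^sup>2 \<partial>M)"
  have quad: "0 \<le> F + r * (2 * B) + r\<^sup>2 * G" for r
  proof -
    have "0 \<le> (\<integral>x. (f x + r * g x)\<^sup>2 \<partial>M)" by simp
    also have "(\<lambda>x. (f x + r * g x)\<^sup>2) = (\<lambda>x. (f x)\<^sup>2 + r * (2 * (f x * g x)) + r\<^sup>2 * (g x)\<^sup>2)"
      by (auto simp: power2_eq_square algebra_simps)
    also have "(\<integral>x. (f x)\<^sup>2 + r * (2 * (f x * g x)) + r\<^sup>2 * (g x)\<^sup>2 \<partial>M) = F + r * (2 * B) + r\<^sup>2 * G"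
      using f g fg by (simp add: F_def B_def G_def)
    finally show ?thesis .
  qed
  have "G \<ge> 0" by (simp add: G_def)
  show "B\<^sup>2 \<le> F * G"
  proof (cases "G = 0")
    case True
    have "B = 0"
    proof (rule ccontr)
      assume "B \<noteq> 0"
      thus False using quad[of "- (F + 1) / (2 * B)"] True by (simp add: field_simps)
    qed
    then show ?thesis using True by simp
  next
    case False
    have "(- B / G) * (2 * B) + (- B / G)\<^sup>2 * G = - (B\<^sup>2 / G)"
      using False by (simp add: power2_eq_square field_simps)
    hence "0 \<le> F - B\<^sup>2 / G" using quad[of "- B / G"] by linarith
    thus ?thesis using False \<open>G \<ge> 0\<close> by (simp add: field_simps)
  qed
qed

context prob_space
begin

lemma centered_gaussian_square_integrable:
  assumes "centered_gaussian M Y"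
  shows "integrable M (\<lambda>\<omega>. (Y \<omega>)\<^sup>2)"
proof -
  have [measurable]: "Y \<in> borel_measurable M" using assms by (simp add: centered_gaussian_def)
  show ?thesis
  proof (cases "AE \<omega> in M. Y \<omega> = 0")
    case True
    hence "AE \<omega> in M. (Y \<omega>)\<^sup>2 = 0" by eventually_elim simp
    then show ?thesis using integrable_cong_AE[of "\<lambda>\<omega>. (Y \<omega>)\<^sup>2" M "\<lambda>_. 0"] by simp
  next
    case False
    then obtain \<sigma> where \<sigma>: "\<sigma> > 0" "distributed M lborel Y (normal_density 0 \<sigma>)"
      using assms by (auto simp: centered_gaussian_def)
    have "integrable M (\<lambda>\<omega>. (\<lambda>x. x\<^sup>2) (Y \<omega>))"
      using integrable_normal_moment[OF \<sigma>(1), of 0 2]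
      by (subst distributed_integrable[OF \<sigma>(2), symmetric]) auto
    then show ?thesis by simp
  qed
qed

text \<open>
  The density of a centered normal variable is at most \<open>1 / (\<sigma> sqrt (2
  \<pi>))\<close>, so an interval of length \<open>2 \<eta>\<close> can carry mass one half only
  if \<open>\<sigma> \<le> 4 \<eta>\<close>. This turns convergence in probability of Gaussian
  variables into convergence in \<open>L\<^sup>2\<close>, without uniform integrability.
\<close>

lemma centered_gaussian_small_variance:
  assumes Y: "centered_gaussian M Y" and \<eta>: "\<eta> > 0" "prob {\<omega> \<in> space M. \<bar>Y \<omega>\<bar> \<le> \<eta>} \<ge> 1 / 2"
  shows "expectation (\<lambda>\<omega>. (Y \<omega>)\<^sup>2) \<le> 16 * \<eta>\<^sup>2"
proof -
  have [measurable]: "Y \<in> borel_measurable M" using Y by (simp add: centered_gaussian_def)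
  show ?thesis
  proof (cases "AE \<omega> in M. Y \<omega> = 0")
    case True
    hence "AE \<omega> in M. (Y \<omega>)\<^sup>2 = 0" by eventually_elim simp
    hence "expectation (\<lambda>\<omega>. (Y \<omega>)\<^sup>2) = expectation (\<lambda>_. 0)" by (intro integral_cong_AE) auto
    then show ?thesis by simp
  next
    case False
    then obtain \<sigma> where \<sigma>: "\<sigma> > 0" "distributed M lborel Y (normal_density 0 \<sigma>)"
      using Y by (auto simp: centered_gaussian_def)
    let ?c = "1 / sqrt (2 * pi * \<sigma>\<^sup>2)"
    have var: "expectation (\<lambda>\<omega>. (Y \<omega>)\<^sup>2) = \<sigma>\<^sup>2"
    proof -
      have "expectation (\<lambda>\<omega>. (Y \<omega>)\<^sup>2) = (\<integral>x. normal_density 0 \<sigma> x * x\<^sup>2 \<partial>lborel)"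
        by (subst distributed_integral[OF \<sigma>(2), symmetric]) auto
      also have "\<dots> = \<sigma>\<^sup>2"
        using integral_normal_moment_even[OF \<sigma>(1), of 0 1] \<sigma>(1) by (simp add: fact_numeral)
      finally show ?thesis .
    qed
    have "ennreal (prob {\<omega> \<in> space M. \<bar>Y \<omega>\<bar> \<le> \<eta>}) = emeasure M (Y -` {- \<eta>..\<eta>} \<inter> space M)"
      by (simp add: emeasure_eq_measure vimage_def Int_def abs_le_iff conj_commute neg_le_iff_le minus_le_iff)
    also have "\<dots> = (\<integral>\<^sup>+x. ennreal (normal_density 0 \<sigma> x) * indicator {- \<eta>..\<eta>} x \<partial>lborel)"
      using \<sigma>(2) by (intro distributed_emeasure) auto
    also have "\<dots> \<le> (\<integral>\<^sup>+x. ennreal ?c * indicator {- \<eta>..\<eta>} x \<partial>lborel)"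
    proof (intro nn_integral_mono mult_right_mono ennreal_leI)
      fix x
      have "normal_density 0 \<sigma> x \<le> ?c * 1"
        unfolding normal_density_def by (intro mult_left_mono) auto
      thus "normal_density 0 \<sigma> x \<le> ?c" by simp
    qed simp
    also have "\<dots> = ennreal ?c * ennreal (2 * \<eta>)"
      using \<eta>(1) by (simp add: nn_integral_cmult_indicator)
    also have "\<dots> = ennreal (?c * (2 * \<eta>))"
      using \<eta>(1) by (intro ennreal_mult[symmetric]) auto
    finally have "prob {\<omega> \<in> space M. \<bar>Y \<omega>\<bar> \<le> \<eta>} \<le> ?c * (2 * \<eta>)"
      using \<eta>(1) by (subst (asm) ennreal_le_iff) (auto intro!: divide_nonneg_nonneg)
    hence half: "1 / 2 \<le> 2 * \<eta> / sqrt (2 * pi * \<sigma>\<^sup>2)" using \<eta>(2) by simp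
    have "\<sigma> \<le> sqrt (2 * pi * \<sigma>\<^sup>2)"
    proof (rule real_le_rsqrt)
      have "1 * \<sigma>\<^sup>2 \<le> 2 * pi * \<sigma>\<^sup>2" using pi_gt3 by (intro mult_right_mono) auto
      thus "\<sigma>\<^sup>2 \<le> 2 * pi * \<sigma>\<^sup>2" by simp
    qed
    also have "sqrt (2 * pi * \<sigma>\<^sup>2) \<le> 4 * \<eta>" using half \<sigma>(1) by (simp add: field_simps)
    finally have "\<sigma>\<^sup>2 \<le> (4 * \<eta>)\<^sup>2" using \<sigma>(1) by (intro power_mono) auto
    thus ?thesis unfolding var by (simp add: power_mult_distrib)
  qed
qed

end

section \<open>The reproducing kernel Hilbert space of a continuous Gaussian process\<close>

locale continuous_gaussian_process = prob_space N for N :: "'v measure" +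
  fixes T :: real and U :: "real \<Rightarrow> 'v \<Rightarrow> real"
  assumes T_pos: "T > 0"
    and continuous: "continuous_process N T U"
    and gaussian: "centered_gaussian_process N T U"
begin

definition cov :: "real \<Rightarrow> real \<Rightarrow> real" where
  "cov s t = expectation (\<lambda>v. U s v * U t v)"

lemma gaussian_U: "t \<in> {0..T} \<Longrightarrow> centered_gaussian N (U t)"
  using gaussian[unfolded centered_gaussian_process_def, rule_format, of "{t}" "\<lambda>_. 1"] by simp

lemma measurable_U: "t \<in> {0..T} \<Longrightarrow> U t \<in> borel_measurable N"
  using gaussian_U by (auto simp: centered_gaussian_def)

lemma square_integrable_U: "t \<in> {0..T} \<Longrightarrow> integrable N (\<lambda>v. (U t v)\<^sup>2)"
  by (intro centered_gaussian_square_integrable gaussian_U)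

lemma gaussian_increment:
  assumes "s \<in> {0..T}" "t \<in> {0..T}"
  shows "centered_gaussian N (\<lambda>v. U s v - U t v)"
proof (cases "s = t")
  case True
  then show ?thesis by (auto simp: centered_gaussian_def)
next
  case False
  then show ?thesis
    using gaussian[unfolded centered_gaussian_process_def, rule_format, of "{s, t}" "\<lambda>r. if r = s then 1 else - 1"] assms
    by simp
qed

text \<open>
  By path continuity the increments tend to 0 pointwise, so for each \<open>\<eta>\<close> they
  are eventually below \<open>\<eta>\<close> with probability at least one half.
\<close>

lemma increment_variance_tendsto_0:
  assumes t: "\<And>n. s n \<in> {0..T}" "t \<in> {0..T}" and lim: "s \<longlonglongrightarrow> t"
  shows "(\<lambda>n. expectation (\<lambda>v. (U (s n) v - U t v)\<^sup>2)) \<longlonglongrightarrow> 0"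
proof (rule LIMSEQ_I)
  fix r :: real assume r: "r > 0"
  define \<eta> where "\<eta> = sqrt r / 5"
  have \<eta>: "\<eta> > 0" "16 * \<eta>\<^sup>2 < r" using r by (auto simp: \<eta>_def power_divide)
  have meas [measurable]: "U (s n) \<in> borel_measurable N" "U t \<in> borel_measurable N" for n
    using t by (auto intro: measurable_U)
  let ?E = "\<lambda>n. {v \<in> space N. \<bar>U (s n) v - U t v\<bar> \<le> \<eta>}"
  have "(\<lambda>n. expectation (indicator (?E n))) \<longlonglongrightarrow> expectation (\<lambda>_. 1 :: real)"
  proof (rule integral_dominated_convergence[where w = "\<lambda>_. 1"])
    show "AE v in N. (\<lambda>n. indicator (?E n) v :: real) \<longlonglongrightarrow> 1"
    proof (intro AE_I2)
      fix v assume v: "v \<in> space N"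
      hence "continuous_on {0..T} (\<lambda>t. U t v)" using continuous by (simp add: continuous_process_def)
      hence "(\<lambda>n. U (s n) v) \<longlonglongrightarrow> U t v"
        using t lim by (auto simp: continuous_on_sequentially comp_def)
      hence "\<forall>\<^sub>F n in sequentially. dist (U (s n) v) (U t v) < \<eta>" using \<eta>(1) by (rule tendstoD)
      hence "\<forall>\<^sub>F n in sequentially. indicator (?E n) v = (1 :: real)"
        by eventually_elim (use v in \<open>auto simp: dist_real_def\<close>)
      thus "(\<lambda>n. indicator (?E n) v :: real) \<longlonglongrightarrow> 1" by (rule tendsto_eventually)
    qed
  qed auto
  hence "(\<lambda>n. prob (?E n)) \<longlonglongrightarrow> 1" by (simp add: prob_space)
  hence "\<forall>\<^sub>F n in sequentially. 1 / 2 < prob (?E n)" by (rule order_tendstoD) simp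
  hence "\<forall>\<^sub>F n in sequentially. expectation (\<lambda>v. (U (s n) v - U t v)\<^sup>2) < r"
  proof eventually_elim
    case (elim n)
    have "expectation (\<lambda>v. (U (s n) v - U t v)\<^sup>2) \<le> 16 * \<eta>\<^sup>2"
      using elim \<eta>(1) t by (intro centered_gaussian_small_variance gaussian_increment) auto
    thus ?case using \<eta>(2) by simp
  qed
  thus "\<exists>no. \<forall>n\<ge>no. norm (expectation (\<lambda>v. (U (s n) v - U t v)\<^sup>2) - 0) < r"
    by (simp add: eventually_sequentially)
qed

lemma continuous_on_expectation_U_mult:
  assumes [measurable]: "W \<in> borel_measurable N" and W: "integrable N (\<lambda>v. (W v)\<^sup>2)"
  shows "continuous_on {0..T} (\<lambda>t. expectation (\<lambda>v. U t v * W v))"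
proof (rule continuous_on_sequentiallyI)
  fix s t assume s: "\<forall>n. s n \<in> {0..T}" and t: "t \<in> {0..T}" and lim: "s \<longlonglongrightarrow> t"
  have s': "s n \<in> {0..T}" for n using s by auto
  have [measurable]: "U (s n) \<in> borel_measurable N" "U t \<in> borel_measurable N" for n
    using s' t by (auto intro: measurable_U)
  let ?D = "\<lambda>n v. U (s n) v - U t v"
  have prods: "integrable N (\<lambda>v. U (s n) v * W v)" "integrable N (\<lambda>v. U t v * W v)" for n
    using s' t W by (auto intro!: integrable_mult_of_square_integrable square_integrable_U measurable_U)
  have sqD: "integrable N (\<lambda>v. (?D n v)\<^sup>2)" for n
    using s' t by (intro centered_gaussian_square_integrable gaussian_increment)
  have le: "(expectation (\<lambda>v. U (s n) v * W v) - expectation (\<lambda>v. U t v * W v))\<^sup>2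
      \<le> expectation (\<lambda>v. (?D n v)\<^sup>2) * expectation (\<lambda>v. (W v)\<^sup>2)" for n
    using Cauchy_Schwarz_lebesgue[OF _ _ sqD[of n] W] prods
    by (simp add: left_diff_distrib)
  have lim0: "(\<lambda>n. expectation (\<lambda>v. (?D n v)\<^sup>2) * expectation (\<lambda>v. (W v)\<^sup>2)) \<longlonglongrightarrow> 0"
    using increment_variance_tendsto_0[OF s' t lim] by (rule tendsto_mult_left_zero)
  have "(\<lambda>n. (expectation (\<lambda>v. U (s n) v * W v) - expectation (\<lambda>v. U t v * W v))\<^sup>2) \<longlonglongrightarrow> 0"
    by (rule tendsto_sandwich[OF _ _ tendsto_const lim0])
       (use le in \<open>simp_all add: always_eventually\<close>)
  hence "(\<lambda>n. expectation (\<lambda>v. U (s n) v * W v) - expectation (\<lambda>v. U t v * W v)) \<longlonglongrightarrow> 0"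
    by (simp add: power_tendsto_0_iff)
  thus "(\<lambda>n. expectation (\<lambda>v. U (s n) v * W v)) \<longlonglongrightarrow> expectation (\<lambda>v. U t v * W v)"
    by (simp add: LIM_zero_iff)
qed

lemma cov_diag: "cov t t = expectation (\<lambda>v. (U t v)\<^sup>2)"
  by (simp add: cov_def power2_eq_square)

lemma cov_diag_nonneg: "cov t t \<ge> 0"
  by (simp add: cov_diag)

lemma continuous_on_cov_diag: "continuous_on {0..T} (\<lambda>t. cov t t)"
proof (rule continuous_on_sequentiallyI)
  fix s t assume s: "\<forall>n. s n \<in> {0..T}" and t: "t \<in> {0..T}" and lim: "s \<longlonglongrightarrow> t"
  have s': "s n \<in> {0..T}" for n using s by auto
  have [measurable]: "U (s n) \<in> borel_measurable N" "U t \<in> borel_measurable N" for n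
    using s' t by (auto intro: measurable_U)
  let ?D = "\<lambda>n v. U (s n) v - U t v"
  have sqD: "integrable N (\<lambda>v. (?D n v)\<^sup>2)" for n
    using s' t by (intro centered_gaussian_square_integrable gaussian_increment)
  have mixed: "integrable N (\<lambda>v. U (s n) v * U t v)" for n
    using s' t by (intro integrable_mult_of_square_integrable square_integrable_U measurable_U) auto
  have split: "cov (s n) (s n) = 2 * cov (s n) t - cov t t + expectation (\<lambda>v. (?D n v)\<^sup>2)" for n
  proof -
    have "(\<lambda>v. (U (s n) v)\<^sup>2) = (\<lambda>v. 2 * (U (s n) v * U t v) - (U t v)\<^sup>2 + (?D n v)\<^sup>2)"
      by (auto simp: power2_eq_square algebra_simps)
    thus ?thesis
      unfolding cov_diag using sqD mixed square_integrable_U[OF t] by (simp add: cov_def)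
  qed
  have "(\<lambda>n. cov (s n) t) \<longlonglongrightarrow> cov t t"
    using continuous_on_expectation_U_mult[OF _ square_integrable_U[OF t]] t s lim
    unfolding cov_def continuous_on_sequentially by (auto simp: comp_def)
  hence "(\<lambda>n. 2 * cov (s n) t - cov t t + expectation (\<lambda>v. (?D n v)\<^sup>2)) \<longlonglongrightarrow> 2 * cov t t - cov t t + 0"
    by (intro tendsto_intros increment_variance_tendsto_0 s' t lim)
  thus "(\<lambda>n. cov (s n) (s n)) \<longlonglongrightarrow> cov t t" by (simp add: split)
qed

text \<open>
  Path continuity makes \<open>U\<close> jointly measurable: it is the pointwise limit of the
  processes sampled at the times \<open>j / (m+1)\<close>, each of which takes countably many
  times only. The minimum with \<open>T\<close> keeps the sampling times in the index set.
\<close>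

lemma measurable_U_pair:
  assumes l: "finite_borel_measure_on T l"
  shows "(\<lambda>(t, v). U t v) \<in> borel_measurable (l \<Otimes>\<^sub>M N)"
proof -
  have sets_l [measurable_cong]: "sets l = sets (restrict_space borel {0..T})"
    using l by (simp add: finite_borel_measure_on_def)
  have space_l: "space l = {0..T}" using sets_eq_imp_space_eq[OF sets_l] by (simp add: space_restrict_space)
  have id: "(\<lambda>t. t) \<in> borel_measurable l"
    unfolding measurable_cong_sets[OF sets_l refl]
    by (rule measurable_restrict_space1) (rule measurable_ident_sets[OF refl])
  let ?r = "\<lambda>m j. min T (real j / real (Suc m))"
  let ?j = "\<lambda>m t. nat \<lfloor>real (Suc m) * t\<rfloor>"
  have r_in: "?r m j \<in> {0..T}" for m j using T_pos by auto
  show ?thesis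
  proof (rule borel_measurable_LIMSEQ_real)
    fix m
    have "(\<lambda>x. ?j m (fst x)) \<in> measurable (l \<Otimes>\<^sub>M N) (count_space UNIV)"
    proof -
      have [measurable]: "(\<lambda>x. fst x) \<in> borel_measurable (l \<Otimes>\<^sub>M N)"
        by (rule measurable_compose[OF measurable_fst id])
      show ?thesis by measurable
    qed
    moreover have "(\<lambda>x. U (?r m j) (snd x)) \<in> borel_measurable (l \<Otimes>\<^sub>M N)" for j
      using measurable_compose[OF measurable_snd measurable_U[OF r_in]] by simp
    ultimately show "(\<lambda>x. U (?r m (?j m (fst x))) (snd x)) \<in> borel_measurable (l \<Otimes>\<^sub>M N)"
      by (rule measurable_compose_countable[rotated])
  next
    fix x assume "x \<in> space (l \<Otimes>\<^sub>M N)"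
    then obtain t v where x: "x = (t, v)" "t \<in> {0..T}" "v \<in> space N"
      using space_l by (auto simp: space_pair_measure)
    have "(\<lambda>m. ?r m (?j m t)) \<longlonglongrightarrow> min T t"
    proof (intro tendsto_min tendsto_const)
      have bounds: "t - 1 / real (Suc m) \<le> real (?j m t) / real (Suc m)"
        "real (?j m t) / real (Suc m) \<le> t" for m
      proof -
        have j: "real (?j m t) = of_int \<lfloor>real (Suc m) * t\<rfloor>" using x(2) by simp
        have "(real (Suc m) * t - 1) / real (Suc m) \<le> real (?j m t) / real (Suc m)"
          unfolding j by (rule divide_right_mono) linarith+
        moreover have "real (?j m t) / real (Suc m) \<le> real (Suc m) * t / real (Suc m)"
          unfolding j by (rule divide_right_mono) (rule of_int_floor_le, simp)
        ultimately show "t - 1 / real (Suc m) \<le> real (?j m t) / real (Suc m)"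
          "real (?j m t) / real (Suc m) \<le> t" by (simp_all add: diff_divide_distrib del: of_nat_Suc)
      qed
      have lim: "(\<lambda>m. t - 1 / real (Suc m)) \<longlonglongrightarrow> t - 0"
        by (intro tendsto_intros LIMSEQ_inverse_real_of_nat[unfolded inverse_eq_divide])
      thus "(\<lambda>m. real (?j m t) / real (Suc m)) \<longlonglongrightarrow> t"
        using bounds
        by (intro tendsto_sandwich[OF _ _ lim[unfolded diff_0_right] tendsto_const] always_eventually allI)
    qed
    moreover have "min T t = t" using x(2) by simp
    moreover have "continuous_on {0..T} (\<lambda>t. U t v)"
      using continuous x(3) by (simp add: continuous_process_def)
    ultimately have "(\<lambda>m. U (?r m (?j m t)) v) \<longlonglongrightarrow> U t v"
      using r_in x(2) unfolding continuous_on_sequentially by (auto simp: comp_def)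
    thus "(\<lambda>m. U (?r m (?j m (fst x))) (snd x)) \<longlonglongrightarrow> (case x of (t, v) \<Rightarrow> U t v)"
      by (simp add: x(1))
  qed
qed

text \<open>
  Fubini: \<open>E[(\<integral> U d\<lambda>) D] = \<integral> E[U(t) D] d\<lambda>(t) =
  0\<close>. Absolute integrability holds because \<open>E |U(t) D|\<close> is bounded uniformly
  in \<open>t\<close>, by Cauchy-Schwarz and the bounded variance of \<open>U\<close>.
\<close>

lemma orthogonal_path_functional:
  assumes [measurable]: "D \<in> borel_measurable N" and D: "integrable N (\<lambda>v. (D v)\<^sup>2)"
    and orth: "\<And>t. t \<in> {0..T} \<Longrightarrow> expectation (\<lambda>v. U t v * D v) = 0"
    and V: "V \<in> path_functionals T U"
  shows "integrable N (\<lambda>v. V v * D v)" "expectation (\<lambda>v. V v * D v) = 0"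
proof -
  have one: "integrable N (\<lambda>v. (\<integral>t. U t v \<partial>l) * D v) \<and> expectation (\<lambda>v. (\<integral>t. U t v \<partial>l) * D v) = 0"
    if l: "finite_borel_measure_on T l" for l
  proof -
    interpret l: finite_measure l using l by (simp add: finite_borel_measure_on_def)
    have sets_l [measurable_cong]: "sets l = sets (restrict_space borel {0..T})"
      using l by (simp add: finite_borel_measure_on_def)
    have space_l: "space l = {0..T}"
      using sets_eq_imp_space_eq[OF sets_l] by (simp add: space_restrict_space)
    interpret pair_sigma_finite l N ..
    have [measurable]: "(\<lambda>(t, v). U t v) \<in> borel_measurable (l \<Otimes>\<^sub>M N)" by (rule measurable_U_pair[OF l])
    have [measurable]: "(\<lambda>(t, v). U t v * D v) \<in> borel_measurable (l \<Otimes>\<^sub>M N)"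
      by (simp add: split_beta') measurable
    have UD: "integrable N (\<lambda>v. U t v * D v)" if "t \<in> {0..T}" for t
      using that D by (intro integrable_mult_of_square_integrable square_integrable_U measurable_U) auto
    obtain t0 where t0: "\<forall>t\<in>{0..T}. cov t t \<le> cov t0 t0"
      using continuous_attains_sup[OF compact_Icc _ continuous_on_cov_diag] T_pos by auto
    define C where "C = cov t0 t0"
    have C: "cov t t \<le> C" if "t \<in> {0..T}" for t using t0 that by (simp add: C_def)
    have bound: "expectation (\<lambda>v. \<bar>U t v * D v\<bar>) \<le> sqrt (C * expectation (\<lambda>v. (D v)\<^sup>2))" if t: "t \<in> {0..T}" for t
    proof (rule real_le_rsqrt)
      have "(expectation (\<lambda>v. \<bar>U t v\<bar> * \<bar>D v\<bar>))\<^sup>2 \<le> cov t t * expectation (\<lambda>v. (D v)\<^sup>2)"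
        using Cauchy_Schwarz_lebesgue[of "\<lambda>v. \<bar>U t v\<bar>" N "\<lambda>v. \<bar>D v\<bar>"] measurable_U[OF t] D square_integrable_U[OF t]
        by (simp add: cov_diag)
      also have "\<dots> \<le> C * expectation (\<lambda>v. (D v)\<^sup>2)" by (intro mult_right_mono C t) simp
      finally show "(expectation (\<lambda>v. \<bar>U t v * D v\<bar>))\<^sup>2 \<le> C * expectation (\<lambda>v. (D v)\<^sup>2)"
        by (simp add: abs_mult)
    qed
    have int: "integrable (l \<Otimes>\<^sub>M N) (\<lambda>(t, v). U t v * D v)"
    proof (rule Fubini_integrable)
      show "integrable l (\<lambda>t. \<integral>v. norm (case (t, v) of (t, v) \<Rightarrow> U t v * D v) \<partial>N)"
        using bound
        by (intro l.integrable_const_bound[where B = "sqrt (C * expectation (\<lambda>v. (D v)\<^sup>2))"])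
           (auto simp: space_l intro!: AE_I2)
      show "AE t in l. integrable N (\<lambda>v. case (t, v) of (t, v) \<Rightarrow> U t v * D v)"
        using UD by (intro AE_I2) (simp add: space_l)
    qed measurable
    have "integrable N (\<lambda>v. \<integral>t. U t v * D v \<partial>l)"
      using integrable_snd[OF int] by simp
    moreover have "(\<integral>v. (\<integral>t. U t v * D v \<partial>l) \<partial>N) = (\<integral>t. (\<integral>v. U t v * D v \<partial>N) \<partial>l)"
      by (rule Fubini_integral[OF int])
    moreover have "(\<integral>t. (\<integral>v. U t v * D v \<partial>N) \<partial>l) = (\<integral>t. 0 \<partial>l)"
      by (intro Bochner_Integration.integral_cong refl orth) (simp add: space_l)
    ultimately show ?thesis by simp
  qed
  obtain l1 l2 where l: "V = (\<lambda>v. (\<integral>t. U t v \<partial>l1) - (\<integral>t. U t v \<partial>l2))"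
    "finite_borel_measure_on T l1" "finite_borel_measure_on T l2"
    using V by (auto simp: path_functionals_def)
  show "integrable N (\<lambda>v. V v * D v)" "expectation (\<lambda>v. V v * D v) = 0"
    using one[OF l(2)] one[OF l(3)] by (simp_all add: l(1) left_diff_distrib)
qed

text \<open>
  Orthogonality passes to \<open>L\<^sup>2\<close>-limits.
\<close>

lemma orthogonal_gaussian_space:
  assumes [measurable]: "D \<in> borel_measurable N" and D: "integrable N (\<lambda>v. (D v)\<^sup>2)"
    and orth: "\<And>t. t \<in> {0..T} \<Longrightarrow> expectation (\<lambda>v. U t v * D v) = 0"
    and Y: "Y \<in> gaussian_space N T U"
  shows "expectation (\<lambda>v. Y v * D v) = 0"
proof -
  have Y' [measurable]: "Y \<in> borel_measurable N" and sqY: "integrable N (\<lambda>v. (Y v)\<^sup>2)"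
    using Y by (auto simp: gaussian_space_def)
  note YD = integrable_mult_of_square_integrable[OF Y' assms(1) sqY D]
  define G where "G = expectation (\<lambda>v. (D v)\<^sup>2)"
  have "G \<ge> 0" by (simp add: G_def)
  have "(expectation (\<lambda>v. Y v * D v))\<^sup>2 \<le> 0 + e" if "e > 0" for e
  proof -
    define \<epsilon> where "\<epsilon> = sqrt (e / (G + 1))"
    have \<epsilon>: "\<epsilon> > 0" using that \<open>G \<ge> 0\<close> by (simp add: \<epsilon>_def)
    then obtain V where V: "V \<in> path_functionals T U" and [measurable]: "V \<in> borel_measurable N"
      and close: "(\<integral>\<^sup>+v. ennreal ((Y v - V v)\<^sup>2) \<partial>N) < ennreal (\<epsilon>\<^sup>2)"
      using Y unfolding gaussian_space_def by blast
    have sq: "integrable N (\<lambda>v. (Y v - V v)\<^sup>2)"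
      using close by (intro integrableI_bounded) (auto intro: less_trans)
    have "ennreal (expectation (\<lambda>v. (Y v - V v)\<^sup>2)) < ennreal (\<epsilon>\<^sup>2)"
      using close by (subst nn_integral_eq_integral[OF sq, symmetric]) auto
    hence le: "expectation (\<lambda>v. (Y v - V v)\<^sup>2) \<le> \<epsilon>\<^sup>2" using \<epsilon> by (simp add: ennreal_less_iff)
    have "expectation (\<lambda>v. Y v * D v) = expectation (\<lambda>v. (Y v - V v) * D v)"
      using orthogonal_path_functional[OF assms(1) D orth V] YD by (simp add: left_diff_distrib)
    also have "\<dots>\<^sup>2 \<le> expectation (\<lambda>v. (Y v - V v)\<^sup>2) * G"
      unfolding G_def by (intro Cauchy_Schwarz_lebesgue sq D) measurable
    also have "\<dots> \<le> \<epsilon>\<^sup>2 * (G + 1)" using le \<open>G \<ge> 0\<close> by (intro mult_mono) auto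
    also have "\<dots> = e" using that \<open>G \<ge> 0\<close> by (simp add: \<epsilon>_def)
    finally show ?thesis by simp
  qed
  hence "(expectation (\<lambda>v. Y v * D v))\<^sup>2 \<le> 0" by (rule field_le_epsilon)
  thus ?thesis by simp
qed

text \<open>
  Let \<open>Y'\<close> be the preimage that the norm is computed from. The difference \<open>D
  = Y - Y'\<close> is orthogonal to every \<open>U(t)\<close>, hence to \<open>Y\<close> and to
  \<open>Y'\<close>, so \<open>E[Y\<^sup>2] = E[Y Y'] = E[Y'\<^sup>2]\<close>.
\<close>

lemma rkhs_norm_rkhs_map:
  assumes Y: "Y \<in> gaussian_space N T U"
  shows "(rkhs_norm N T U (rkhs_map N T U Y))\<^sup>2 = expectation (\<lambda>v. (Y v)\<^sup>2)"
proof -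
  define Y' where "Y' = inv_into (gaussian_space N T U) (rkhs_map N T U) (rkhs_map N T U Y)"
  have Y': "Y' \<in> gaussian_space N T U" "rkhs_map N T U Y' = rkhs_map N T U Y"
    unfolding Y'_def by (rule inv_into_into[OF imageI[OF Y]], rule f_inv_into_f[OF imageI[OF Y]])
  have [measurable]: "Y \<in> borel_measurable N" "Y' \<in> borel_measurable N"
    and sq: "integrable N (\<lambda>v. (Y v)\<^sup>2)" "integrable N (\<lambda>v. (Y' v)\<^sup>2)"
    using Y Y' by (auto simp: gaussian_space_def)
  have prod: "integrable N (\<lambda>v. Y v * Y' v)"
    by (intro integrable_mult_of_square_integrable sq) auto
  define D where "D = (\<lambda>v. Y v - Y' v)"
  have [measurable]: "D \<in> borel_measurable N" by (simp add: D_def)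
  have sqD: "integrable N (\<lambda>v. (D v)\<^sup>2)"
    using sq prod by (simp add: D_def power2_diff mult.assoc)
  have orth: "expectation (\<lambda>v. U t v * D v) = 0" if t: "t \<in> {0..T}" for t
  proof -
    have "expectation (\<lambda>v. U t v * Y' v) = expectation (\<lambda>v. U t v * Y v)"
      using fun_cong[OF Y'(2), of t] t by (simp add: rkhs_map_def)
    moreover have "integrable N (\<lambda>v. U t v * Y v)" "integrable N (\<lambda>v. U t v * Y' v)"
      using t sq by (auto intro!: integrable_mult_of_square_integrable square_integrable_U measurable_U)
    ultimately show ?thesis by (simp add: D_def right_diff_distrib)
  qed
  have "expectation (\<lambda>v. Y v * D v) = 0" "expectation (\<lambda>v. Y' v * D v) = 0"
    using orthogonal_gaussian_space[OF _ sqD orth] Y Y' by auto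
  hence "expectation (\<lambda>v. (Y v)\<^sup>2) = expectation (\<lambda>v. (Y' v)\<^sup>2)"
    using sq prod by (simp add: D_def right_diff_distrib power2_eq_square mult.commute)
  moreover have "(rkhs_norm N T U (rkhs_map N T U Y))\<^sup>2 = expectation (\<lambda>v. (Y' v)\<^sup>2)"
    by (simp add: rkhs_norm_def rkhs_inner_def power2_eq_square flip: Y'_def)
  ultimately show ?thesis by simp
qed

text \<open>
  \<open>c U(s)\<close> is the functional of the signed measure \<open>c
  \<delta>\<^sub>s\<close>, whose Jordan decomposition puts the positive part of
  \<open>c\<close> in one measure and the negative part in the other.
\<close>

lemma multiple_in_gaussian_space:
  assumes s: "s \<in> {0..T}"
  shows "(\<lambda>v. c * U s v) \<in> gaussian_space N T U"
proof -
  have [measurable]: "U s \<in> borel_measurable N" using s by (rule measurable_U)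
  let ?S = "restrict_space borel {0..T} :: real measure"
  define l where "l = (\<lambda>a. density (return ?S s) (\<lambda>_. ennreal a))"
  have fin: "finite_borel_measure_on T (l a)" for a
  proof -
    have top: "space ?S \<in> sets (return ?S s)" by (simp only: sets_return sets.top)
    have "emeasure (l a) (space (l a)) = emeasure (l a) (space ?S)" by (simp add: l_def)
    also have "\<dots> = (\<integral>\<^sup>+t. ennreal a * indicator (space ?S) t \<partial>return ?S s)"
      unfolding l_def by (rule emeasure_density[OF _ top]) simp
    also have "\<dots> = ennreal a * emeasure (return ?S s) (space ?S)"
      by (rule nn_integral_cmult_indicator[OF top])
    also have "\<dots> = ennreal a * indicator (space ?S) s" by (simp only: emeasure_return[OF sets.top])
    also have "\<dots> < \<infinity>" by (simp add: ennreal_mult_less_top indicator_def)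
    finally show ?thesis
      unfolding finite_borel_measure_on_def by (auto intro!: finite_measureI simp: l_def)
  qed
  have int: "(\<integral>t. U t v \<partial>l a) = a * U s v" if "a \<ge> 0" "v \<in> space N" for a v
  proof -
    have "continuous_on {0..T} (\<lambda>t. U t v)" using continuous that(2) by (simp add: continuous_process_def)
    hence [measurable]: "(\<lambda>t. U t v) \<in> borel_measurable ?S"
      by (rule borel_measurable_continuous_on_restrict)
    have "(\<integral>t. U t v \<partial>l a) = (\<integral>t. a *\<^sub>R U t v \<partial>return ?S s)"
      unfolding l_def using that(1) by (intro integral_density) auto
    also have "\<dots> = a * U s v"
      using s by (subst integral_return) (auto simp: space_restrict_space)
    finally show ?thesis .
  qed
  define V where "V = (\<lambda>v. (\<integral>t. U t v \<partial>l (max c 0)) - (\<integral>t. U t v \<partial>l (max (- c) 0)))"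
  have V: "V \<in> path_functionals T U" unfolding V_def path_functionals_def using fin by blast
  have V_eq: "V v = c * U s v" if "v \<in> space N" for v
    using that by (simp add: V_def int max_def)
  have "V \<in> borel_measurable N" using measurable_cong[of N V "\<lambda>v. c * U s v" borel] V_eq by simp
  moreover have "(\<integral>\<^sup>+v. ennreal ((c * U s v - V v)\<^sup>2) \<partial>N) = (\<integral>\<^sup>+v. 0 \<partial>N)"
    by (intro nn_integral_cong) (simp add: V_eq)
  ultimately show ?thesis
    using V square_integrable_U[OF s] unfolding gaussian_space_def
    by (auto simp: power_mult_distrib)
qed

lemma gaussian_rate_cov:
  assumes s: "s \<in> {0..T}"
  shows "gaussian_rate N T U (\<lambda>t\<in>{0..T}. c * cov t s) = ennreal (1 / 2 * c\<^sup>2 * cov s s)"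
proof -
  let ?Y = "\<lambda>v. c * U s v"
  note Y = multiple_in_gaussian_space[OF s, of c]
  have h: "rkhs_map N T U ?Y = (\<lambda>t\<in>{0..T}. c * cov t s)"
    by (simp add: rkhs_map_def cov_def mult.left_commute)
  hence "(\<lambda>t\<in>{0..T}. c * cov t s) \<in> rkhs N T U" unfolding rkhs_def using Y by (metis imageI)
  moreover have "(rkhs_norm N T U (\<lambda>t\<in>{0..T}. c * cov t s))\<^sup>2 = c\<^sup>2 * cov s s"
    using rkhs_norm_rkhs_map[OF Y] by (simp add: h cov_diag power_mult_distrib)
  ultimately show ?thesis by (simp add: gaussian_rate_def)
qed

text \<open>
  The reproducing property and Cauchy-Schwarz: \<open>h(t)\<^sup>2 = E[U(t) Y]\<^sup>2 \<le>
  k(t,t) E[Y\<^sup>2]\<close>. Where \<open>k(t,t) = 0\<close> every path of finite energy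
  vanishes.
\<close>

lemma gaussian_rate_ge:
  assumes t: "t \<in> {0..T}" and y: "0 < y" "y \<le> h t"
  shows "ennreal (1 / 2) * (ennreal (y\<^sup>2) / ennreal (cov t t)) \<le> gaussian_rate N T U h"
proof (cases "h \<in> rkhs N T U")
  case True
  then obtain Y where Y: "Y \<in> gaussian_space N T U" and h: "h = rkhs_map N T U Y"
    by (auto simp: rkhs_def)
  have [measurable]: "Y \<in> borel_measurable N" "U t \<in> borel_measurable N"
    and sq: "integrable N (\<lambda>v. (Y v)\<^sup>2)"
    using Y measurable_U[OF t] by (auto simp: gaussian_space_def)
  define n where "n = expectation (\<lambda>v. (Y v)\<^sup>2)"
  have "h t = expectation (\<lambda>v. U t v * Y v)" using t by (simp add: h rkhs_map_def)
  hence CS: "(h t)\<^sup>2 \<le> cov t t * n"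
    unfolding cov_diag n_def using square_integrable_U[OF t] sq
    by (simp add: Cauchy_Schwarz_lebesgue)
  have "0 < y\<^sup>2" using y by simp
  also have le: "y\<^sup>2 \<le> cov t t * n" 
  proof -
    have "y\<^sup>2 \<le> (h t)\<^sup>2" using y by (intro power_mono) auto
    thus ?thesis using CS by linarith
  qed
  finally have pos: "cov t t > 0" using cov_diag_nonneg[of t] by (cases "cov t t = 0") auto
  have "ennreal (1 / 2) * (ennreal (y\<^sup>2) / ennreal (cov t t)) = ennreal (1 / 2 * (y\<^sup>2 / cov t t))"
    using pos by (subst ennreal_mult) (simp_all add: divide_ennreal)
  also have "\<dots> \<le> ennreal (1 / 2 * n)"
    using le pos by (intro ennreal_leI) (simp add: field_simps)
  also have "\<dots> = gaussian_rate N T U h"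
    using True rkhs_norm_rkhs_map[OF Y] by (simp add: gaussian_rate_def h n_def)
  finally show ?thesis .
qed (simp add: gaussian_rate_def)

lemma continuous_on_cov: "s \<in> {0..T} \<Longrightarrow> continuous_on {0..T} (\<lambda>t. cov t s)"
  unfolding cov_def by (intro continuous_on_expectation_U_mult square_integrable_U measurable_U)

end

section \<open>Crossing a boundary in path space\<close>

lemma topspace_path_space:
  fixes T :: real
  shows "topspace (path_space T :: (real \<Rightarrow> 'a::euclidean_space) topology) =
    {h. h \<in> extensional {0..T} \<and> continuous_on {0..T} h}"
proof -
  have "topspace (path_space T :: (real \<Rightarrow> 'a) topology) = mspace (cfunspace (top_of_set {0..T}) euclidean_metric)"
    by (simp add: path_space_def)
  also have "\<dots> = {h. h \<in> extensional {0..T} \<and> continuous_on {0..T} h}"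
    by (subst compactin_mspace_cfunspace) (auto simp: compactin_subtopology)
  finally show ?thesis .
qed

lemma openin_path_spaceI:
  fixes S :: "(real \<Rightarrow> 'a::euclidean_space) set"
  assumes sub: "S \<subseteq> topspace (path_space T)"
    and near: "\<And>h. h \<in> S \<Longrightarrow> \<exists>e>0. \<forall>g\<in>topspace (path_space T).
                 (\<forall>t\<in>{0..T}. dist (h t) (g t) \<le> e) \<longrightarrow> g \<in> S"
  shows "openin (path_space T) S"
proof -
  let ?m = "cfunspace (top_of_set {0..T}) (euclidean_metric :: 'a metric)"
  interpret Metric_space "mspace ?m" "mdist ?m" by (rule Metric_space_mspace_mdist)
  have top: "topspace (path_space T) = mspace ?m" by (simp add: path_space_def)
  have "\<exists>r>0. mball h r \<subseteq> S" if h: "h \<in> S" for h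
  proof -
    obtain e where e: "e > 0" "\<forall>g\<in>mspace ?m. (\<forall>t\<in>{0..T}. dist (h t) (g t) \<le> e) \<longrightarrow> g \<in> S"
      using near[OF h] unfolding top by auto
    have "mball h e \<subseteq> S"
    proof
      fix g assume g: "g \<in> mball h e"
      hence "g \<in> mspace ?m" "h \<in> mspace ?m" "mdist ?m h g \<le> e" by (auto simp only: in_mball less_imp_le)
      moreover from mdist_cfunspace_imp_mdist_le[OF this(2,1,3)]
      have "\<forall>t\<in>{0..T}. dist (h t) (g t) \<le> e" by simp
      ultimately show "g \<in> S" using e(2) by blast
    qed
    thus ?thesis using e(1) by blast
  qed
  hence "openin mtopology S" using sub unfolding openin_mtopology top by blast
  thus ?thesis by (simp add: path_space_def mtopology_of_def)
qed

lemma openin_path_space_exceed: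
  fixes \<phi> :: "real \<Rightarrow> real"
  shows "openin (path_space T) {h \<in> topspace (path_space T). \<exists>t\<in>{0..T}. \<phi> t < (h t :: real ^ 'p) $ i}"
proof (rule openin_path_spaceI)
  fix h :: "real \<Rightarrow> real ^ 'p"
  assume "h \<in> {h \<in> topspace (path_space T). \<exists>t\<in>{0..T}. \<phi> t < h t $ i}"
  then obtain t where t: "t \<in> {0..T}" "\<phi> t < h t $ i" by auto
  define e where "e = (h t $ i - \<phi> t) / 2"
  have e: "e > 0" "\<phi> t + 2 * e = h t $ i" using t by (simp_all add: e_def field_simps)
  show "\<exists>e>0. \<forall>g\<in>topspace (path_space T). (\<forall>t\<in>{0..T}. dist (h t) (g t) \<le> e) \<longrightarrow>
      g \<in> {h \<in> topspace (path_space T). \<exists>t\<in>{0..T}. \<phi> t < h t $ i}"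
  proof (intro exI[of _ e] conjI ballI impI)
    show "0 < e" by (rule e(1))
  next
    fix g :: "real \<Rightarrow> real ^ 'p"
    assume g: "g \<in> topspace (path_space T)" "\<forall>t\<in>{0..T}. dist (h t) (g t) \<le> e"
    have "dist (h t $ i) (g t $ i) \<le> e" using g(2) t(1) dist_vec_nth_le order_trans by blast
    hence "\<phi> t < g t $ i" using e by (simp add: dist_real_def)
    thus "g \<in> {h \<in> topspace (path_space T). \<exists>t\<in>{0..T}. \<phi> t < h t $ i}" using g(1) t(1) by blast
  qed
qed auto

text \<open>
  A path strictly below a continuous boundary on a compact interval keeps a positive distance
  from it.
\<close>

lemma closedin_path_space_reach:
  fixes \<phi> :: "real \<Rightarrow> real"
  assumes T: "T \<ge> 0" and \<phi>: "continuous_on {0..T} \<phi>"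
  shows "closedin (path_space T) {h \<in> topspace (path_space T). \<exists>t\<in>{0..T}. \<phi> t \<le> (h t :: real ^ 'p) $ i}"
    (is "closedin _ ?C")
proof -
  have "openin (path_space T) (topspace (path_space T) - ?C)"
  proof (rule openin_path_spaceI)
    fix h :: "real \<Rightarrow> real ^ 'p"
    assume "h \<in> topspace (path_space T) - ?C"
    hence h: "continuous_on {0..T} h" "\<And>t. t \<in> {0..T} \<Longrightarrow> h t $ i < \<phi> t"
      by (auto simp: topspace_path_space not_le)
    have "continuous_on {0..T} (\<lambda>t. \<phi> t - h t $ i)" by (intro continuous_intros \<phi> h(1))
    then obtain s where s: "s \<in> {0..T}" "\<forall>t\<in>{0..T}. \<phi> s - h s $ i \<le> \<phi> t - h t $ i"
      using continuous_attains_inf[OF compact_Icc, of 0 T "\<lambda>t. \<phi> t - h t $ i"] T by auto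
    define e where "e = (\<phi> s - h s $ i) / 2"
    have e: "e > 0" "\<phi> s - h s $ i = 2 * e" using h(2)[OF s(1)] by (auto simp: e_def)
    show "\<exists>e>0. \<forall>g\<in>topspace (path_space T). (\<forall>t\<in>{0..T}. dist (h t) (g t) \<le> e) \<longrightarrow>
        g \<in> topspace (path_space T) - ?C"
    proof (intro exI[of _ e] conjI ballI impI)
    show "0 < e" by (rule e(1))
  next
      fix g :: "real \<Rightarrow> real ^ 'p"
      assume g: "g \<in> topspace (path_space T)" "\<forall>t\<in>{0..T}. dist (h t) (g t) \<le> e"
      have "g t $ i < \<phi> t" if t: "t \<in> {0..T}" for t
      proof -
        have "dist (h t $ i) (g t $ i) \<le> e" using g(2) t dist_vec_nth_le order_trans by blast
        moreover have "2 * e \<le> \<phi> t - h t $ i" using s(2) t e(2) by auto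
        ultimately show ?thesis using e(1) unfolding dist_real_def by linarith
      qed
      thus "g \<in> topspace (path_space T) - ?C" using g(1) by fastforce
    qed
  qed auto
  thus ?thesis by (auto simp: closedin_def)
qed

text \<open>
  A path that reaches \<open>s f\<close> at time \<open>t\<close> costs at least
  \<open>s\<^sup>2 f(t)\<^sup>2 / (2 k(t,t))\<close> through its \<open>i\<close>-th component
  alone. Conversely, for \<open>r > s\<close> the path with \<open>i\<close>-th component
  \<open>(r f(t) / k(t,t)) k(\<cdot>,t)\<close> and all others zero exceeds \<open>s f\<close>
  at time \<open>t\<close>, at cost \<open>r\<^sup>2 f(t)\<^sup>2 / (2 k(t,t))\<close>; then
  \<open>r\<close> decreases to \<open>s\<close>.
\<close>

lemma tendsto_decay_rate_boundary_crossing: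
  fixes X :: "nat \<Rightarrow> real \<Rightarrow> 'w \<Rightarrow> real ^ 'p" and N :: "'p \<Rightarrow> 'v measure"
  assumes U: "\<And>j. continuous_gaussian_process (N j) T (U j)"
    and M: "prob_space M" and X: "\<And>n. continuous_process M T (X n)"
    and LDP: "random_elements_LDP M (path_space T) (\<lambda>n. sample_path T (X n)) \<gamma>
           (\<lambda>h. \<Sum>j\<in>UNIV. gaussian_rate (N j) T (U j) (\<lambda>t\<in>{0..T}. h t $ j))"
    and f: "continuous_on {0..T} f" "\<And>t. t \<in> {0..T} \<Longrightarrow> f t > 0" and s: "s > 0"
  shows "(\<lambda>n. decay_rate (\<gamma> n) (measure M {\<omega> \<in> space M. \<exists>t\<in>{0..T}. s * f t \<le> X n t \<omega> $ i})) \<longlonglongrightarrow>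
    ennreal (s\<^sup>2) * (INF t\<in>{0..T}. ennreal (1 / 2) *
      (ennreal ((f t)\<^sup>2) / ennreal (continuous_gaussian_process.cov (N i) (U i) t t)))"
proof -
  interpret Ui: continuous_gaussian_process "N i" T "U i" by (rule U)
  let ?I = "\<lambda>h. \<Sum>j\<in>UNIV. gaussian_rate (N j) T (U j) (\<lambda>t\<in>{0..T}. h t $ j)"
  define g where "g = (\<lambda>t. ennreal (1 / 2) * (ennreal ((f t)\<^sup>2) / ennreal (Ui.cov t t)))"
  define \<Theta> where "\<Theta> = {h \<in> topspace (path_space T). \<exists>t\<in>{0..T}. s * f t < (h t :: real ^ 'p) $ i}"
  define \<Gamma> where "\<Gamma> = {h \<in> topspace (path_space T). \<exists>t\<in>{0..T}. s * f t \<le> (h t :: real ^ 'p) $ i}"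
  have "(INF h\<in>\<Theta>. ?I h) \<le> ennreal (s\<^sup>2) * g t" if t: "t \<in> {0..T}" for t
  proof (cases "Ui.cov t t = 0")
    case True
    hence "g t = \<infinity>" using f(2)[OF t] by (simp add: g_def ennreal_mult_top)
    thus ?thesis using s by (simp add: ennreal_mult_top)
  next
    case False
    define q where "q = 1 / 2 * ((f t)\<^sup>2 / Ui.cov t t)"
    have cov: "Ui.cov t t > 0" using False Ui.cov_diag_nonneg[of t] by simp
    have g: "ennreal (s\<^sup>2) * g t = ennreal (s\<^sup>2 * q)"
      using cov by (simp add: g_def q_def ennreal_mult divide_ennreal del: times_divide_eq_left times_divide_eq_right)
    have "(INF h\<in>\<Theta>. ?I h) \<le> ennreal (r\<^sup>2 * q)" if r: "r > s" for r
    proof -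
      define c where "c = r * f t / Ui.cov t t"
      define c' where "c' = (\<lambda>j. if j = i then c else 0)"
      define h where "h = (\<lambda>u\<in>{0..T}. \<chi> j. c' j * continuous_gaussian_process.cov (N j) (U j) u t)"
      have comp: "(\<lambda>u\<in>{0..T}. h u $ j) = (\<lambda>u\<in>{0..T}. c' j * continuous_gaussian_process.cov (N j) (U j) u t)" for j
        by (auto simp: h_def)
      have "continuous_on {0..T} (\<lambda>u. \<chi> j. c' j * continuous_gaussian_process.cov (N j) (U j) u t)"
        by (intro continuous_on_vec_lambda continuous_on_mult_left
            continuous_gaussian_process.continuous_on_cov[OF U] t)
      hence "continuous_on {0..T} h" by (rule continuous_on_eq) (simp add: h_def)
      moreover have "h \<in> extensional {0..T}" by (simp add: h_def)
      moreover have "h t $ i = r * f t" using t cov by (simp add: h_def c'_def c_def)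
      ultimately have "h \<in> \<Theta>"
        using r f(2)[OF t] t \<open>h \<in> extensional {0..T}\<close>
        by (auto simp: \<Theta>_def topspace_path_space intro!: bexI[of _ t])
      have "?I h = (\<Sum>j\<in>UNIV. if j = i then ennreal (1 / 2 * c\<^sup>2 * Ui.cov t t) else 0)"
        unfolding comp using continuous_gaussian_process.gaussian_rate_cov[OF U t]
        by (intro sum.cong) (auto simp: c'_def)
      also have "\<dots> = ennreal (r\<^sup>2 * q)"
        using cov by (simp add: c_def q_def power2_eq_square field_simps)
      finally show ?thesis using \<open>h \<in> \<Theta>\<close> by (intro INF_lower2[of h]) auto
    qed
    hence ev: "\<forall>\<^sub>F r in at_right s. (INF h\<in>\<Theta>. ?I h) \<le> ennreal (r\<^sup>2 * q)"
      by (auto simp: eventually_at_right_field intro!: exI[of _ "s + 1"])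
    have "((\<lambda>r. ennreal (r\<^sup>2 * q)) \<longlongrightarrow> ennreal (s\<^sup>2 * q)) (at_right s)"
      by (intro tendsto_ennrealI tendsto_intros)
    thus ?thesis unfolding g using ev by (rule tendsto_lowerbound) simp
  qed
  hence upper: "(INF h\<in>\<Theta>. ?I h) \<le> ennreal (s\<^sup>2) * (INF t\<in>{0..T}. g t)"
    using s by (subst ennreal_mult_INF) (auto intro!: INF_greatest)
  have lower: "ennreal (s\<^sup>2) * (INF t\<in>{0..T}. g t) \<le> (INF h\<in>\<Gamma>. ?I h)"
  proof (rule INF_greatest)
    fix h assume "h \<in> \<Gamma>"
    then obtain t where t: "t \<in> {0..T}" "s * f t \<le> h t $ i" by (auto simp: \<Gamma>_def)
    have "ennreal (s\<^sup>2) * (INF t\<in>{0..T}. g t) \<le> ennreal (s\<^sup>2) * g t"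
      using t(1) by (intro mult_left_mono INF_lower) auto
    also have "\<dots> = ennreal (1 / 2) * (ennreal ((s * f t)\<^sup>2) / ennreal (Ui.cov t t))"
      by (simp only: g_def power_mult_distrib ennreal_mult zero_le_power2 ennreal_times_divide mult.left_commute)
    also have "\<dots> \<le> gaussian_rate (N i) T (U i) (\<lambda>t\<in>{0..T}. h t $ i)"
      using t s f(2)[OF t(1)] by (intro Ui.gaussian_rate_ge) auto
    also have "\<dots> \<le> ?I h" by (rule member_le_sum) auto
    finally show "ennreal (s\<^sup>2) * (INF t\<in>{0..T}. g t) \<le> ?I h" .
  qed
  have "(\<lambda>n. decay_rate (\<gamma> n) (measure M {\<omega> \<in> space M. sample_path T (X n) \<omega> \<in> \<Gamma>})) \<longlonglongrightarrow>
      ennreal (s\<^sup>2) * (INF t\<in>{0..T}. g t)"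
  proof (rule tendsto_decay_rate_LDP[OF LDP M _ upper _ lower])
    show "openin (path_space T) \<Theta>" unfolding \<Theta>_def by (rule openin_path_space_exceed)
    show "closedin (path_space T) \<Gamma>"
      unfolding \<Gamma>_def using Ui.T_pos by (intro closedin_path_space_reach continuous_intros f(1)) auto
    show "\<Theta> \<subseteq> \<Gamma>" unfolding \<Theta>_def \<Gamma>_def by (auto intro: less_imp_le)
  qed
  moreover have "{\<omega> \<in> space M. sample_path T (X n) \<omega> \<in> \<Gamma>} =
      {\<omega> \<in> space M. \<exists>t\<in>{0..T}. s * f t \<le> X n t \<omega> $ i}" for n
  proof -
    have "sample_path T (X n) \<omega> \<in> topspace (path_space T)" if "\<omega> \<in> space M" for \<omega>
    proof -
      have "continuous_on {0..T} (\<lambda>t. X n t \<omega>)" using X that by (simp add: continuous_process_def)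
      hence "continuous_on {0..T} (sample_path T (X n) \<omega>)"
        by (rule continuous_on_eq) (simp add: sample_path_def)
      thus ?thesis by (simp add: topspace_path_space sample_path_def)
    qed
    thus ?thesis by (auto simp: \<Gamma>_def sample_path_def)
  qed
  ultimately show ?thesis by (simp add: g_def)
qed

section \<open>The maximal ratio of a path to a boundary\<close>

text \<open>
  The maximum of \<open>h / f\<close> over \<open>[0,T]\<close> for continuous functions. Only
  rational times enter, so that it is measurable for the product \<open>\<sigma>\<close>-algebra
  in which independence of processes is expressed. That product space also contains functions
  with \<open>h / f\<close> unbounded, where the extended supremum becomes the harmless default
  value of \<open>real_of_ereal\<close>.
\<close>

definition running_ratio :: "real \<Rightarrow> (real \<Rightarrow> real) \<Rightarrow> (real \<Rightarrow> real) \<Rightarrow> real" where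
  "running_ratio T f h = real_of_ereal (SUP t\<in>{0..T} \<inter> \<rat>. ereal (h t / f t))"

lemma running_ratio_restrict [simp]: "running_ratio T f (restrict h {0..T}) = running_ratio T f h"
  unfolding running_ratio_def by (intro arg_cong[where f = real_of_ereal] SUP_cong) auto

lemma measurable_running_ratio:
  "running_ratio T f \<in> borel_measurable (\<Pi>\<^sub>M t\<in>{0..T}. borel)"
proof -
  have "countable ({0..T} \<inter> \<rat>)" using countable_rat by blast
  moreover have "(\<lambda>h. ereal (h t / f t)) \<in> borel_measurable (\<Pi>\<^sub>M t\<in>{0..T}. borel)" if "t \<in> {0..T} \<inter> \<rat>" for t
  proof -
    have [measurable]: "(\<lambda>h. h t) \<in> borel_measurable (\<Pi>\<^sub>M t\<in>{0..T}. borel :: real measure)"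
      using that by (intro measurable_component_singleton) auto
    show ?thesis by measurable
  qed
  ultimately show ?thesis unfolding running_ratio_def
    by (intro borel_measurable_real_of_ereal borel_measurable_SUP)
qed

text \<open>
  The maximum is attained, at \<open>m\<close> say, and rational times close to \<open>m\<close>
  approximate its value.
\<close>

lemma le_running_ratio_iff:
  assumes T: "T > 0" and h: "continuous_on {0..T} h" and f: "continuous_on {0..T} f"
    and pos: "\<And>t. t \<in> {0..T} \<Longrightarrow> f t > 0"
  shows "s \<le> running_ratio T f h \<longleftrightarrow> (\<exists>t\<in>{0..T}. s * f t \<le> h t)"
proof -
  let ?r = "\<lambda>t. h t / f t"
  have "f t \<noteq> 0" if "t \<in> {0..T}" for t using pos[OF that] by simp
  hence cont: "continuous_on {0..T} ?r" by (intro continuous_intros h f) auto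
  then obtain m where m: "m \<in> {0..T}" "\<And>t. t \<in> {0..T} \<Longrightarrow> ?r t \<le> ?r m"
    using continuous_attains_sup[OF compact_Icc, of 0 T ?r] T by auto
  have "(SUP t\<in>{0..T} \<inter> \<rat>. ereal (?r t)) = ereal (?r m)"
  proof (rule antisym)
    show "(SUP t\<in>{0..T} \<inter> \<rat>. ereal (?r t)) \<le> ereal (?r m)"
      using m(2) by (intro SUP_least) auto
    show "ereal (?r m) \<le> (SUP t\<in>{0..T} \<inter> \<rat>. ereal (?r t))"
    proof (rule ereal_le_epsilon2)
      fix e :: real assume e: "e > 0"
      obtain \<delta> where \<delta>: "\<delta> > 0" "\<And>t. t \<in> {0..T} \<Longrightarrow> dist t m < \<delta> \<Longrightarrow> dist (?r t) (?r m) < e"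
        using cont m(1) e unfolding continuous_on_iff by blast
      have "max 0 (m - \<delta>) < min T (m + \<delta>)" using \<delta>(1) m(1) T by auto
      then obtain q where q: "q \<in> \<rat>" "max 0 (m - \<delta>) < q" "q < min T (m + \<delta>)"
        using Rats_dense_in_real by blast
      have "dist (?r q) (?r m) < e" using q by (intro \<delta>(2)) (auto simp: dist_real_def)
      hence "?r m \<le> ?r q + e" by (simp add: dist_real_def)
      hence "ereal (?r m) \<le> ereal (?r q) + ereal e" by simp
      also have "\<dots> \<le> (SUP t\<in>{0..T} \<inter> \<rat>. ereal (?r t)) + ereal e"
        using q by (intro add_right_mono SUP_upper) auto
      finally show "ereal (?r m) \<le> (SUP t\<in>{0..T} \<inter> \<rat>. ereal (?r t)) + ereal e" .
    qed
  qed
  hence eq: "running_ratio T f h = ?r m" by (simp add: running_ratio_def)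
  have "s \<le> ?r m \<longleftrightarrow> (\<exists>t\<in>{0..T}. s \<le> ?r t)" using m order.trans by blast
  also have "\<dots> \<longleftrightarrow> (\<exists>t\<in>{0..T}. s * f t \<le> h t)"
    using pos by (intro bex_cong refl) (simp add: pos_le_divide_eq)
  finally show ?thesis unfolding eq .
qed

lemma le_SUP_iff_attained:
  fixes z :: "real \<Rightarrow> real"
  assumes "T \<ge> 0" "continuous_on {0..T} z"
  shows "x \<le> (SUP t\<in>{0..T}. z t) \<longleftrightarrow> (\<exists>t\<in>{0..T}. x \<le> z t)"
proof -
  obtain m where m: "m \<in> {0..T}" "\<And>t. t \<in> {0..T} \<Longrightarrow> z t \<le> z m"
    using continuous_attains_sup[OF compact_Icc _ assms(2)] assms(1) by auto
  hence "(SUP t\<in>{0..T}. z t) = z m" by (intro cSup_eq_maximum) auto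
  thus ?thesis using m order.trans by fastforce
qed

section \<open>Independence across components\<close>

context prob_space
begin

lemma indep_elements_prob:
  assumes ind: "indep_elements M S Y S' Y'" and B: "B \<in> sets S" and C: "C \<in> sets S'"
  shows "prob {\<omega> \<in> space M. Y \<omega> \<in> B \<and> Y' \<omega> \<in> C} =
           prob {\<omega> \<in> space M. Y \<omega> \<in> B} * prob {\<omega> \<in> space M. Y' \<omega> \<in> C}"
proof -
  have ind': "indep_set (sets (vimage_algebra (space M) Y S)) (sets (vimage_algebra (space M) Y' S'))"
    using ind by (simp add: indep_elements_def)
  have eq: "Y -` B \<inter> space M = {\<omega> \<in> space M. Y \<omega> \<in> B}" "Y' -` C \<inter> space M = {\<omega> \<in> space M. Y' \<omega> \<in> C}"
    by auto
  have "prob ({\<omega> \<in> space M. Y \<omega> \<in> B} \<inter> {\<omega> \<in> space M. Y' \<omega> \<in> C}) =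
      prob {\<omega> \<in> space M. Y \<omega> \<in> B} * prob {\<omega> \<in> space M. Y' \<omega> \<in> C}"
    using in_vimage_algebra[OF B, of Y "space M"] in_vimage_algebra[OF C, of Y' "space M"]
    by (intro indep_setD[OF ind']) (simp_all add: eq)
  moreover have "{\<omega> \<in> space M. Y \<omega> \<in> B} \<inter> {\<omega> \<in> space M. Y' \<omega> \<in> C} = {\<omega> \<in> space M. Y \<omega> \<in> B \<and> Y' \<omega> \<in> C}"
    by auto
  ultimately show ?thesis by simp
qed

text \<open>
  All the variables \<open>a i (Y)\<close> and \<open>s i (Y')\<close> together form one
  independent family, indexed by a disjoint sum. Grouping the two members with the same
  \<open>i\<close> keeps independence, and the event depends on each group through the product
  of its members.
\<close>

lemma prob_components_mult:
  fixes a :: "'i::finite \<Rightarrow> 'b \<Rightarrow> real" and s :: "'i \<Rightarrow> 'c \<Rightarrow> real"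
  assumes ind: "indep_elements M S Y S' Y'"
    and a [measurable]: "\<And>i. a i \<in> borel_measurable S" and s [measurable]: "\<And>i. s i \<in> borel_measurable S'"
    and ind_a: "indep_vars (\<lambda>_. borel) (\<lambda>i \<omega>. a i (Y \<omega>)) UNIV"
    and ind_s: "indep_vars (\<lambda>_. borel) (\<lambda>i \<omega>. s i (Y' \<omega>)) UNIV"
  shows "prob {\<omega> \<in> space M. \<forall>i. c \<le> a i (Y \<omega>) * s i (Y' \<omega>)} =
           (\<Prod>i\<in>UNIV. prob {\<omega> \<in> space M. c \<le> a i (Y \<omega>) * s i (Y' \<omega>)})"
proof -
  have Y [measurable]: "Y \<in> measurable M S" and Y' [measurable]: "Y' \<in> measurable M S'"
    using ind by (simp_all add: indep_elements_def)
  define X where "X = case_sum (\<lambda>i \<omega>. a i (Y \<omega>)) (\<lambda>i \<omega>. s i (Y' \<omega>))"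
  have rv: "random_variable borel (X k)" for k by (cases k) (simp_all add: X_def)
  have "indep_vars (\<lambda>_. borel) X UNIV"
    unfolding indep_vars_def2
  proof (intro conjI ballI rv)
    show "indep_sets (\<lambda>k. {X k -` B \<inter> space M |B. B \<in> sets borel}) UNIV"
    proof (subst indep_sets_finite)
      show "{X k -` B \<inter> space M |B. B \<in> sets borel} \<subseteq> events" for k
        using measurable_sets[OF rv] by auto
      show "space M \<in> {X k -` B \<inter> space M |B. B \<in> sets borel}" for k
        by (rule CollectI, rule exI[of _ UNIV]) auto
      show "\<forall>A\<in>Pi UNIV (\<lambda>k. {X k -` B \<inter> space M |B. B \<in> sets borel}).
          prob (\<Inter>k\<in>UNIV. A k) = (\<Prod>k\<in>UNIV. prob (A k))"
      proof
        fix A assume "A \<in> Pi UNIV (\<lambda>k. {X k -` B \<inter> space M |B. B \<in> sets borel})"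
        hence "\<forall>k. \<exists>B. A k = X k -` B \<inter> space M \<and> B \<in> sets borel" by (simp add: Pi_iff)
        then obtain B where B: "\<And>k. B k \<in> sets borel" "\<And>k. A k = X k -` B k \<inter> space M" by metis
        let ?L = "{y \<in> space S. \<forall>i. a i y \<in> B (Inl i)}" and ?R = "{y \<in> space S'. \<forall>i. s i y \<in> B (Inr i)}"
        have [measurable]: "B k \<in> sets borel" for k by (rule B(1))
        have L: "{\<omega> \<in> space M. Y \<omega> \<in> ?L} = (\<Inter>i\<in>UNIV. A (Inl i))"
          using measurable_space[OF Y] by (auto simp: B(2) X_def)
        have R: "{\<omega> \<in> space M. Y' \<omega> \<in> ?R} = (\<Inter>i\<in>UNIV. A (Inr i))"
          using measurable_space[OF Y'] by (auto simp: B(2) X_def)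
        have "(\<Inter>k\<in>UNIV. A k) = (\<Inter>i\<in>UNIV. A (Inl i)) \<inter> (\<Inter>i\<in>UNIV. A (Inr i))"
          
        proof (rule set_eqI)
          fix \<omega>
          have "(\<forall>k. \<omega> \<in> A k) \<longleftrightarrow> (\<forall>i. \<omega> \<in> A (Inl i)) \<and> (\<forall>i. \<omega> \<in> A (Inr i))"
            by (metis sum.exhaust)
          thus "\<omega> \<in> (\<Inter>k\<in>UNIV. A k) \<longleftrightarrow> \<omega> \<in> (\<Inter>i\<in>UNIV. A (Inl i)) \<inter> (\<Inter>i\<in>UNIV. A (Inr i))"
            by simp
        qed
        also have "\<dots> = {\<omega> \<in> space M. Y \<omega> \<in> ?L \<and> Y' \<omega> \<in> ?R}" unfolding L[symmetric] R[symmetric] by blast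
        finally have "prob (\<Inter>k\<in>UNIV. A k) = prob {\<omega> \<in> space M. Y \<omega> \<in> ?L \<and> Y' \<omega> \<in> ?R}" by simp
        also have "\<dots> = prob {\<omega> \<in> space M. Y \<omega> \<in> ?L} * prob {\<omega> \<in> space M. Y' \<omega> \<in> ?R}"
          by (intro indep_elements_prob[OF ind]) measurable
        also have "prob {\<omega> \<in> space M. Y \<omega> \<in> ?L} = (\<Prod>i\<in>UNIV. prob (A (Inl i)))"
          unfolding L using indep_varsD_finite[OF ind_a, of "\<lambda>i. B (Inl i)"] by (simp add: B X_def)
        also have "prob {\<omega> \<in> space M. Y' \<omega> \<in> ?R} = (\<Prod>i\<in>UNIV. prob (A (Inr i)))"
          unfolding R using indep_varsD_finite[OF ind_s, of "\<lambda>i. B (Inr i)"] by (simp add: B X_def)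
        also have "(\<Prod>i\<in>UNIV. prob (A (Inl i))) * (\<Prod>i\<in>UNIV. prob (A (Inr i))) = (\<Prod>k\<in>UNIV <+> UNIV. prob (A k))"
          by (subst prod.Plus) (simp_all add: comp_def)
        finally show "prob (\<Inter>k\<in>UNIV. A k) = (\<Prod>k\<in>UNIV. prob (A k))" by simp
      qed
    qed auto
  qed
  hence "indep_vars (\<lambda>i. PiM {Inl i, Inr i} (\<lambda>_. borel)) (\<lambda>i \<omega>. restrict (\<lambda>k. X k \<omega>) {Inl i, Inr i}) UNIV"
    by (rule indep_vars_restrict) (auto simp: disjoint_family_on_def)
  hence "indep_vars (\<lambda>_. borel) (\<lambda>i \<omega>. (\<lambda>z. z (Inl i) * z (Inr i)) (restrict (\<lambda>k. X k \<omega>) {Inl i, Inr i})) UNIV"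
    by (rule indep_vars_compose2) (auto intro!: borel_measurable_times measurable_component_singleton)
  hence prod: "indep_vars (\<lambda>_. borel) (\<lambda>i \<omega>. a i (Y \<omega>) * s i (Y' \<omega>)) UNIV" by (simp add: X_def)
  have "prob (\<Inter>i\<in>UNIV. (\<lambda>\<omega>. a i (Y \<omega>) * s i (Y' \<omega>)) -` {c..} \<inter> space M) =
      (\<Prod>i\<in>UNIV. prob ((\<lambda>\<omega>. a i (Y \<omega>) * s i (Y' \<omega>)) -` {c..} \<inter> space M))"
    by (rule indep_varsD_finite[OF prod]) auto
  moreover have "(\<Inter>i\<in>UNIV. (\<lambda>\<omega>. a i (Y \<omega>) * s i (Y' \<omega>)) -` {c..} \<inter> space M) =
      {\<omega> \<in> space M. \<forall>i. c \<le> a i (Y \<omega>) * s i (Y' \<omega>)}" by auto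
  moreover have "(\<lambda>\<omega>. a i (Y \<omega>) * s i (Y' \<omega>)) -` {c..} \<inter> space M = {\<omega> \<in> space M. c \<le> a i (Y \<omega>) * s i (Y' \<omega>)}" for i
    by auto
  ultimately show ?thesis by simp
qed

end

section \<open>The limit of the crossing probabilities\<close>

theorem proposition4p4:
  fixes T :: real
    and M :: "'w measure"
    and X :: "nat \<Rightarrow> real \<Rightarrow> 'w \<Rightarrow> real ^ 'p"
    and A :: "nat \<Rightarrow> 'w \<Rightarrow> real ^ 'p"
    and N :: "'p \<Rightarrow> 'v measure"
    and U :: "'p \<Rightarrow> real \<Rightarrow> 'v \<Rightarrow> real"
    and k :: "'p \<Rightarrow> real \<Rightarrow> real \<Rightarrow> real"
    and \<gamma> :: "nat \<Rightarrow> real"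
    and d \<theta> x :: "'p \<Rightarrow> real"
    and b :: "real \<Rightarrow> real ^ 'p"
    and Z :: "nat \<Rightarrow> real \<Rightarrow> 'w \<Rightarrow> real ^ 'p"
    and p :: "nat \<Rightarrow> real"
  assumes "T > 0"
    and "prob_space M"
    (* k i is the covariance function of a continuous centered Gaussian process U i *)
    and "\<And>i. prob_space (N i)"
    and "\<And>i. continuous_process (N i) T (U i)"
    and "\<And>i. centered_gaussian_process (N i) T (U i)"
    and "\<And>i s t. s \<in> {0..T} \<Longrightarrow> t \<in> {0..T} \<Longrightarrow> k i s t = (\<integral>v. U i s v * U i t v \<partial>N i)"
    (* the processes X n *)
    and "\<And>n. continuous_process M T (X n)"
    and "\<And>n. centered_gaussian_process M T (X n)"
    and "\<And>n \<omega>. \<omega> \<in> space M \<Longrightarrow> X n 0 \<omega> = 0"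
    and "\<And>n. prob_space.indep_vars M (\<lambda>i. \<Pi>\<^sub>M t\<in>{0..T}. borel)
               (\<lambda>i \<omega>. \<lambda>t\<in>{0..T}. X n t \<omega> $ i) UNIV"
    and "random_elements_LDP M (path_space T) (\<lambda>n. sample_path T (X n)) \<gamma>
           (\<lambda>h. \<Sum>i\<in>UNIV. gaussian_rate (N i) T (U i) (\<lambda>t\<in>{0..T}. h t $ i))"
    and "good_rate_function (path_space T)
           (\<lambda>h :: real \<Rightarrow> real ^ 'p. \<Sum>i\<in>UNIV. gaussian_rate (N i) T (U i) (\<lambda>t\<in>{0..T}. h t $ i))"
    (* the random factors A n *)
    and "indep_elements M
           (\<Pi>\<^sub>M n\<in>UNIV. borel) (\<lambda>\<omega> n. A n \<omega>)
           (\<Pi>\<^sub>M nt\<in>UNIV \<times> {0..T}. borel) (\<lambda>\<omega>. \<lambda>(n, t)\<in>UNIV \<times> {0..T}. X n t \<omega>)"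
    and "\<And>n. prob_space.indep_vars M (\<lambda>i. borel) (\<lambda>i \<omega>. A n \<omega> $ i) UNIV"
    and "\<And>n i \<omega>. \<omega> \<in> space M \<Longrightarrow> A n \<omega> $ i > 0"
    and "\<And>i. random_elements_LDP M (top_of_set {0..}) (\<lambda>n \<omega>. A n \<omega> $ i) \<gamma>
               (\<lambda>a. ennreal (d i * a powr \<theta> i))"
    and "\<And>i. good_rate_function (top_of_set {0..}) (\<lambda>a. ennreal (d i * a powr \<theta> i))"
    and "\<And>i. d i > 0"
    and "\<And>i. \<theta> i > 2"
    (* the process Z n and the probabilities p n *)
    and "continuous_on {0..T} b"
    and "\<And>i. x i > 0"
    and "\<And>i t. t \<in> {0..T} \<Longrightarrow> x i - b t $ i > 0"
    and "\<And>n t \<omega>. Z n t \<omega> = (\<chi> i. A n \<omega> $ i * X n t \<omega> $ i) + b t"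
    and "\<And>n. p n = measure M {\<omega> \<in> space M. \<forall>i. (SUP t\<in>{0..T}. Z n t \<omega> $ i) \<ge> x i}"
  shows "(\<lambda>n. ereal (1 / \<gamma> n) * log0 (p n)) \<longlonglongrightarrow>
           - enn2ereal (INF t\<in>{t. \<forall>i. t i \<in> {0..T}}.
               \<Sum>i\<in>UNIV. ennreal (\<psi> (d i) (\<theta> i)) *
                 epowr (ennreal (1/2) * (ennreal ((- (b (t i) $ i) + x i)\<^sup>2) / ennreal (k i (t i) (t i))))
                       (\<theta> i / (\<theta> i + 2)))"
proof -
  note asm = assms
  note T = asm(1) and M = asm(2) and X_cont = asm(7) and ind_X = asm(10) and LDP_X = asm(11)
    and ind = asm(13) and ind_A = asm(14) and A_pos = asm(15) and LDP_A = asm(16)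
    and d = asm(18) and b = asm(20) and Z = asm(23) and p = asm(24)
  have \<theta>: "\<theta> i > 0" for i using asm(19)[of i] by simp
  interpret prob_space M by (rule M)
  have U: "continuous_gaussian_process (N i) T (U i)" for i
    using asm(1,3,4,5) by (simp add: continuous_gaussian_process_def continuous_gaussian_process_axioms_def)
  have k: "k i t t = continuous_gaussian_process.cov (N i) (U i) t t" if "t \<in> {0..T}" for i t
    using asm(6) that by (simp add: continuous_gaussian_process.cov_def[OF U])
  have speed: "speed \<gamma>" using LDP_X by (simp add: random_elements_LDP_def LDP_def)
  hence \<gamma>: "\<gamma> n > 0" for n by (simp add: speed_def)
  \<comment> \<open>Dividing the event by the distance to the level turns it into \<open>A S \<ge> 1\<close>.\<close>
  define f where "f = (\<lambda>i t. x i - b t $ i)"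
  have f_cont: "continuous_on {0..T} (f i)" for i
    unfolding f_def by (intro continuous_intros b)
  have f_pos: "f i t > 0" if "t \<in> {0..T}" for i t using asm(22)[OF that] by (simp add: f_def)
  have X_cont': "continuous_on {0..T} (\<lambda>t. X n t \<omega> $ i)" if "\<omega> \<in> space M" for n i \<omega>
    using X_cont[of n] that by (intro continuous_intros) (simp add: continuous_process_def)
  define S where "S = (\<lambda>i n \<omega>. running_ratio T (f i) (\<lambda>t. X n t \<omega> $ i))"
  have S_iff: "s \<le> S i n \<omega> \<longleftrightarrow> (\<exists>t\<in>{0..T}. s * f i t \<le> X n t \<omega> $ i)" if "\<omega> \<in> space M" for s i n \<omega>
    unfolding S_def by (rule le_running_ratio_iff[OF T X_cont'[OF that] f_cont f_pos])
  have crossing: "x i \<le> (SUP t\<in>{0..T}. Z n t \<omega> $ i) \<longleftrightarrow> 1 \<le> A n \<omega> $ i * S i n \<omega>"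
    if \<omega>: "\<omega> \<in> space M" for i n \<omega>
  proof -
    have Z': "Z n t \<omega> $ i = A n \<omega> $ i * X n t \<omega> $ i + b t $ i" for t by (simp add: Z)
    have "continuous_on {0..T} (\<lambda>t. Z n t \<omega> $ i)"
      unfolding Z' by (intro continuous_intros X_cont'[OF \<omega>] b)
    hence "x i \<le> (SUP t\<in>{0..T}. Z n t \<omega> $ i) \<longleftrightarrow> (\<exists>t\<in>{0..T}. x i \<le> Z n t \<omega> $ i)"
      using T by (intro le_SUP_iff_attained) auto
    also have "\<dots> \<longleftrightarrow> (\<exists>t\<in>{0..T}. 1 / A n \<omega> $ i * f i t \<le> X n t \<omega> $ i)"
      using A_pos[OF \<omega>, of n i] by (intro bex_cong refl) (simp add: Z' f_def field_simps)
    also have "\<dots> \<longleftrightarrow> 1 \<le> A n \<omega> $ i * S i n \<omega>"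
      unfolding S_iff[OF \<omega>, symmetric] using A_pos[OF \<omega>, of n i] by (simp add: field_simps)
    finally show ?thesis .
  qed

  \<comment> \<open>\<open>A\<^sup>n\<close> and \<open>S\<close> as measurable functions of the two families that are independent by assumption\<close>
  let ?SA = "\<Pi>\<^sub>M n\<in>(UNIV :: nat set). (borel :: (real ^ 'p) measure)"
  let ?SX = "\<Pi>\<^sub>M nt\<in>(UNIV :: nat set) \<times> {0..T}. (borel :: (real ^ 'p) measure)"
  let ?Y = "\<lambda>\<omega> n. A n \<omega>" and ?Y' = "\<lambda>\<omega>. \<lambda>(n, t)\<in>UNIV \<times> {0..T}. X n t \<omega>"
  define a where "a = (\<lambda>n i (y :: nat \<Rightarrow> real ^ 'p). y n $ i)"
  define \<sigma> where "\<sigma> = (\<lambda>n i (z :: nat \<times> real \<Rightarrow> real ^ 'p). running_ratio T (f i) (\<lambda>t\<in>{0..T}. z (n, t) $ i))"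
  have nth: "(\<lambda>v :: real ^ 'p. v $ i) \<in> borel_measurable borel" for i
    by (intro borel_measurable_continuous_onI continuous_intros)
  have a_meas: "a n i \<in> borel_measurable ?SA" for n i
    unfolding a_def
    by (rule measurable_compose[OF measurable_component_singleton[of n UNIV "\<lambda>_. borel"] nth]) simp
  have \<sigma>_meas: "\<sigma> n i \<in> borel_measurable ?SX" for n i
    unfolding \<sigma>_def
  proof (rule measurable_compose[OF measurable_restrict measurable_running_ratio])
    fix t assume "t \<in> {0..T}"
    thus "(\<lambda>z. z (n, t) $ i) \<in> borel_measurable ?SX"
      by (intro measurable_compose[OF measurable_component_singleton[of "(n, t)" _ "\<lambda>_. borel"] nth]) simp
  qed
  have a_Y: "a n i (?Y \<omega>) = A n \<omega> $ i" for n i \<omega> by (simp add: a_def)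
  have \<sigma>_Y': "\<sigma> n i (?Y' \<omega>) = S i n \<omega>" for n i \<omega>
  proof -
    have eq: "(\<lambda>t\<in>{0..T}. ?Y' \<omega> (n, t) $ i) = (\<lambda>t\<in>{0..T}. X n t \<omega> $ i)" by auto
    show ?thesis unfolding \<sigma>_def S_def eq by (rule running_ratio_restrict)
  qed
  have A_meas: "(\<lambda>\<omega>. A n \<omega> $ i) \<in> borel_measurable M" for n i
    using measurable_compose[OF _ a_meas[of n i], of ?Y M] ind by (simp add: a_Y indep_elements_def)
  have S_meas: "S i n \<in> borel_measurable M" for n i
    using measurable_compose[OF _ \<sigma>_meas[of n i], of ?Y' M] ind by (simp add: \<sigma>_Y' indep_elements_def)

  let ?q = "\<lambda>n i. prob {\<omega> \<in> space M. 1 \<le> A n \<omega> $ i * S i n \<omega>}"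
  have p_prod: "p n = (\<Prod>i\<in>UNIV. ?q n i)" for n
  proof -
    have "indep_vars (\<lambda>_. borel) (\<lambda>i \<omega>. running_ratio T (f i) (\<lambda>t\<in>{0..T}. X n t \<omega> $ i)) UNIV"
      using measurable_running_ratio by (intro indep_vars_compose2[OF ind_X])
    hence "indep_vars (\<lambda>_. borel) (\<lambda>i \<omega>. S i n \<omega>) UNIV" by (simp add: S_def)
    hence ind_S: "indep_vars (\<lambda>_. borel) (\<lambda>i \<omega>. \<sigma> n i (?Y' \<omega>)) UNIV" by (simp only: \<sigma>_Y')
    have ind_A': "indep_vars (\<lambda>_. borel) (\<lambda>i \<omega>. a n i (?Y \<omega>)) UNIV" using ind_A by (simp only: a_Y)
    have "p n = prob {\<omega> \<in> space M. \<forall>i. 1 \<le> A n \<omega> $ i * S i n \<omega>}"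
      unfolding p using crossing by (intro arg_cong[where f = prob]) auto
    also have "\<dots> = (\<Prod>i\<in>UNIV. ?q n i)"
      using prob_components_mult[where a = "a n" and s = "\<sigma> n" and c = 1,
          OF ind a_meas \<sigma>_meas ind_A' ind_S]
      by (simp only: a_Y \<sigma>_Y')
    finally show ?thesis .
  qed

  define g where "g = (\<lambda>i t. ennreal (1 / 2) * (ennreal ((f i t)\<^sup>2) / ennreal (k i t t)))"
  have g_pos: "g i t > 0" if "t \<in> {0..T}" for i t
    using f_pos[OF that, of i]
    unfolding g_def ennreal_zero_less_mult_iff ennreal_zero_less_divide ennreal_less_zero_iff by simp
  define W where "W = (\<lambda>i. INF t\<in>{0..T}. ennreal (\<psi> (d i) (\<theta> i)) * epowr (g i t) (\<theta> i / (\<theta> i + 2)))"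
  have lim_q: "(\<lambda>n. decay_rate (\<gamma> n) (?q n i)) \<longlonglongrightarrow> W i" for i
  proof -
    have "(\<lambda>n. decay_rate (\<gamma> n) (prob {\<omega> \<in> space M. s \<le> S i n \<omega>})) \<longlonglongrightarrow>
        ennreal (s\<^sup>2) * (INF t\<in>{0..T}. g i t)" if "s > 0" for s
    proof -
      have "{\<omega> \<in> space M. s \<le> S i n \<omega>} = {\<omega> \<in> space M. \<exists>t\<in>{0..T}. s * f i t \<le> X n t \<omega> $ i}" for n
        by (intro Collect_cong conj_cong refl S_iff)
      thus ?thesis
        using tendsto_decay_rate_boundary_crossing[OF U M X_cont LDP_X f_cont[of i] f_pos that]
        by (simp add: g_def k)
    qed
    moreover have "prob {\<omega> \<in> space M. r \<le> A n \<omega> $ i \<and> s \<le> S i n \<omega>} =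
        prob {\<omega> \<in> space M. r \<le> A n \<omega> $ i} * prob {\<omega> \<in> space M. s \<le> S i n \<omega>}" for n r s
    proof -
      have Y: "?Y \<omega> \<in> space ?SA" "?Y' \<omega> \<in> space ?SX" for \<omega>
        by (auto simp: space_PiM)
      have "{y \<in> space ?SA. r \<le> a n i y} \<in> sets ?SA" "{z \<in> space ?SX. s \<le> \<sigma> n i z} \<in> sets ?SX"
        using a_meas[of n i] \<sigma>_meas[of n i] by measurable
      from indep_elements_prob[OF ind this] show ?thesis
        using Y by (simp only: mem_Collect_eq a_Y \<sigma>_Y' simp_thms)
    qed
    ultimately have "(\<lambda>n. decay_rate (\<gamma> n) (?q n i)) \<longlonglongrightarrow>
        (INF r\<in>{0<..}. ennreal (d i * r powr \<theta> i) + ennreal ((1 / r)\<^sup>2) * (INF t\<in>{0..T}. g i t))"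
      using A_pos
      by (intro tendsto_decay_rate_product[OF M speed d \<theta> A_meas S_meas]
          tendsto_decay_rate_power_tail[OF LDP_A M d \<theta>])
    also have "(INF r\<in>{0<..}. ennreal (d i * r powr \<theta> i) + ennreal ((1 / r)\<^sup>2) * (INF t\<in>{0..T}. g i t)) = W i"
      unfolding W_def using d \<theta> g_pos by (rule INF_trade_off_INF_eq)
    finally show ?thesis .
  qed

  have "(\<lambda>n. \<Sum>i\<in>UNIV. decay_rate (\<gamma> n) (?q n i)) \<longlonglongrightarrow> (\<Sum>i\<in>UNIV. W i)"
    by (intro tendsto_sum lim_q)
  hence "(\<lambda>n. decay_rate (\<gamma> n) (p n)) \<longlonglongrightarrow> (\<Sum>i\<in>UNIV. W i)"
    by (simp add: p_prod decay_rate_prod \<gamma>)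
  hence "(\<lambda>n. - enn2ereal (decay_rate (\<gamma> n) (p n))) \<longlonglongrightarrow> - enn2ereal (\<Sum>i\<in>UNIV. W i)"
    by (intro tendsto_uminus_ereal) (simp add: tendsto_enn2ereal_iff)
  moreover have "ereal (1 / \<gamma> n) * log0 (p n) = - enn2ereal (decay_rate (\<gamma> n) (p n))" for n
    by (rule scaled_log0_eq_decay_rate) (auto simp: \<gamma> p)
  moreover have "(\<Sum>i\<in>UNIV. W i) = (INF t\<in>{t. \<forall>i. t i \<in> {0..T}}. \<Sum>i\<in>UNIV. ennreal (\<psi> (d i) (\<theta> i)) *
      epowr (ennreal (1/2) * (ennreal ((- (b (t i) $ i) + x i)\<^sup>2) / ennreal (k i (t i) (t i)))) (\<theta> i / (\<theta> i + 2)))"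
    unfolding W_def sum_INF_eq_INF_sum by (simp add: g_def f_def)
  ultimately show ?thesis by simp
qed

end
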